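(* Let $F$ be a compact, connected, oriented surface with exactly one boundary component, let $\phi: F \to F$ be a periodic, orientation preserving homeomorphism, and let $k$ be an integer relatively prime to the order of $\phi$. Then the peripheral group pairs $(\pi_1(M_\phi), i_*(\pi_1(\partial M_\phi)))$ and $(\pi_1(M_{\phi^k}), i_*(\pi_1(\partial M_{\phi^k})))$ have the same finite quotients.
   Context: A homeomorphism $\phi: F\to F$ is periodic if $\phi^n = \mathrm{id}_F$ for some $n \ge 1$; its order is the least such $n$. $M_\phi = (F\times[0,1])/\big((\phi(x),0) = (x,1)\big)$ is the mapping torus; here $\partial M_\phi$ is connected. The map $i_*:\pi_1(\partial M_\phi)\to\pi_1(M_\phi)$ is induced by inclusion; its image is a subgroup well defined up to conjugation, and the peripheral group pair $(\pi_1(M_\phi), i_*(\pi_1(\partial M_\phi)))$ is well defined up to isomorphism of group pairs. A group pair $(G,H)$ is a group $G$ with a subgroup $H$; an isomorphism of pairs $(G,H)\to(G',H')$ is an isomorphism $G\to G'$ carrying $H$ onto $H'$. The finite quotients of a pair $(G,H)$ are the group pairs $(G/N, HN/N)$ (equivalently $(G/N, H/(N\cap H))$), where $N$ ranges over the normal subgroups of finite index in $G$. Two pairs have the same finite quotients if the sets of isomorphism classes of their finite quotient pairs coincide. *)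

theory Defs
  imports "HOL-Analysis.Analysis" "HOL-Homology.Homology"
begin

section \<open>Manifolds with boundary\<close>

definition half_space :: "nat \<Rightarrow> (nat \<Rightarrow> real) topology" where
  "half_space n = subtopology (Euclidean_space n) {y. 0 \<le> y 0}"

definition manifold_with_boundary :: "nat \<Rightarrow> 'a topology \<Rightarrow> bool" where
  "manifold_with_boundary n X \<longleftrightarrow>
     Hausdorff_space X \<and> second_countable X \<and>
     (\<forall>x\<in>topspace X. \<exists>U V. openin X U \<and> x \<in> U \<and> openin (half_space n) V \<and>
        subtopology X U homeomorphic_space subtopology (half_space n) V)"

definition manifold_interior :: "nat \<Rightarrow> 'a topology \<Rightarrow> 'a set" where
  "manifold_interior n X =
     {x \<in> topspace X. \<exists>U V. openin X U \<and> x \<in> U \<and> openin (Euclidean_space n) V \<and>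
        subtopology X U homeomorphic_space subtopology (Euclidean_space n) V}"

definition manifold_boundary :: "nat \<Rightarrow> 'a topology \<Rightarrow> 'a set" where
  "manifold_boundary n X = topspace X - manifold_interior n X"

section \<open>Orientations\<close>

text \<open>An orientation is a choice of a generator \<open>\<mu> x\<close> of the infinite cyclic group
  \<open>H\<^sub>n(X, X - {x})\<close> for every interior point \<open>x\<close>, such that nearby generators are
  restrictions of one class in \<open>H\<^sub>n(X, X - U)\<close>. Values of \<open>\<mu>\<close> at other points are irrelevant.\<close>

definition local_homology_group :: "nat \<Rightarrow> 'a topology \<Rightarrow> 'a \<Rightarrow> 'a chain set monoid" where
  "local_homology_group n X x = relative_homology_group (int n) X (topspace X - {x})"

definition manifold_orientation ::
    "nat \<Rightarrow> 'a topology \<Rightarrow> ('a \<Rightarrow> 'a chain set) \<Rightarrow> bool" where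
  "manifold_orientation n X \<mu> \<longleftrightarrow>
     (\<forall>x\<in>manifold_interior n X.
        \<mu> x \<in> carrier (local_homology_group n X x) \<and>
        generate (local_homology_group n X x) {\<mu> x} = carrier (local_homology_group n X x)) \<and>
     (\<forall>x\<in>manifold_interior n X. \<exists>U \<alpha>. openin X U \<and> x \<in> U \<and> U \<subseteq> manifold_interior n X \<and>
        \<alpha> \<in> carrier (relative_homology_group (int n) X (topspace X - U)) \<and>
        (\<forall>y\<in>U. hom_induced (int n) X (topspace X - U) X (topspace X - {y}) id \<alpha> = \<mu> y))"

definition orientation_preserving ::
    "nat \<Rightarrow> 'a topology \<Rightarrow> ('a \<Rightarrow> 'a chain set) \<Rightarrow> ('a \<Rightarrow> 'a) \<Rightarrow> bool" where
  "orientation_preserving n X \<mu> \<phi> \<longleftrightarrow>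
     (\<forall>x\<in>manifold_interior n X.
        hom_induced (int n) X (topspace X - {x}) X (topspace X - {\<phi> x}) \<phi> (\<mu> x) = \<mu> (\<phi> x))"

section \<open>Periodic homeomorphisms\<close>

text \<open>Functions are total on the carrier type, so identities between self-maps of a space are
  required on its underlying set only.\<close>

definition periodic_on :: "'a topology \<Rightarrow> ('a \<Rightarrow> 'a) \<Rightarrow> bool" where
  "periodic_on X \<phi> \<longleftrightarrow> (\<exists>n\<ge>1. \<forall>x\<in>topspace X. (\<phi> ^^ n) x = x)"

definition homeo_order :: "'a topology \<Rightarrow> ('a \<Rightarrow> 'a) \<Rightarrow> nat" where
  "homeo_order X \<phi> = (LEAST n. n \<ge> 1 \<and> (\<forall>x\<in>topspace X. (\<phi> ^^ n) x = x))"

definition homeo_power :: "'a topology \<Rightarrow> ('a \<Rightarrow> 'a) \<Rightarrow> int \<Rightarrow> 'a \<Rightarrow> 'a" where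
  "homeo_power X \<phi> k =
     (if k \<ge> 0 then \<phi> ^^ nat k else inv_into (topspace X) \<phi> ^^ nat (- k))"

section \<open>Mapping tori\<close>

definition generated_equivalence :: "('a \<times> 'a) set \<Rightarrow> ('a \<times> 'a) set" where
  "generated_equivalence r = (r \<union> r\<inverse>)\<^sup>*"

definition quotient_topology :: "'a topology \<Rightarrow> ('a \<times> 'a) set \<Rightarrow> 'a set topology" where
  "quotient_topology X r = topology (\<lambda>\<U>.
     \<U> \<subseteq> topspace X // generated_equivalence r \<and>
     openin X {x \<in> topspace X. generated_equivalence r `` {x} \<in> \<U>})"

lemma openin_quotient_topology:
  "openin (quotient_topology X r) \<U> \<longleftrightarrow>
     \<U> \<subseteq> topspace X // generated_equivalence r \<and>
     openin X {x \<in> topspace X. generated_equivalence r `` {x} \<in> \<U>}"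
proof -
  let ?q = "\<lambda>x. generated_equivalence r `` {x}"
  have "istopology (\<lambda>\<U>. \<U> \<subseteq> topspace X // generated_equivalence r \<and>
          openin X {x \<in> topspace X. ?q x \<in> \<U>})"
    unfolding istopology_def
  proof (intro conjI allI impI)
    fix S T
    assume "S \<subseteq> topspace X // generated_equivalence r \<and> openin X {x \<in> topspace X. ?q x \<in> S}"
       and "T \<subseteq> topspace X // generated_equivalence r \<and> openin X {x \<in> topspace X. ?q x \<in> T}"
    moreover have "{x \<in> topspace X. ?q x \<in> S \<inter> T} =
        {x \<in> topspace X. ?q x \<in> S} \<inter> {x \<in> topspace X. ?q x \<in> T}" by blast
    ultimately show "S \<inter> T \<subseteq> topspace X // generated_equivalence r"
      and "openin X {x \<in> topspace X. ?q x \<in> S \<inter> T}" by auto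
  next
    fix \<K>
    assume K: "\<forall>K\<in>\<K>. K \<subseteq> topspace X // generated_equivalence r \<and>
                 openin X {x \<in> topspace X. ?q x \<in> K}"
    then show "\<Union>\<K> \<subseteq> topspace X // generated_equivalence r" by blast
    have "{x \<in> topspace X. ?q x \<in> \<Union>\<K>} = (\<Union>K\<in>\<K>. {x \<in> topspace X. ?q x \<in> K})" by blast
    then show "openin X {x \<in> topspace X. ?q x \<in> \<Union>\<K>}" using K by auto
  qed
  then show ?thesis
    unfolding quotient_topology_def by (simp add: topology_inverse')
qed

lemma topspace_quotient_topology:
  "topspace (quotient_topology X r) = topspace X // generated_equivalence r"
proof
  show "topspace (quotient_topology X r) \<subseteq> topspace X // generated_equivalence r"
    using openin_quotient_topology openin_topspace by metis
  have "{x \<in> topspace X. generated_equivalence r `` {x} \<in> topspace X // generated_equivalence r}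
          = topspace X"
    by (auto intro: quotientI)
  then have "openin (quotient_topology X r) (topspace X // generated_equivalence r)"
    by (simp add: openin_quotient_topology)
  then show "topspace X // generated_equivalence r \<subseteq> topspace (quotient_topology X r)"
    by (rule openin_subset)
qed

lemma quotient_map_quotient_topology:
  "quotient_map X (quotient_topology X r) (\<lambda>x. generated_equivalence r `` {x})"
  unfolding quotient_map_def topspace_quotient_topology openin_quotient_topology
  by (auto simp: quotient_def)

definition mapping_torus :: "'a topology \<Rightarrow> ('a \<Rightarrow> 'a) \<Rightarrow> ('a \<times> real) set topology" where
  "mapping_torus F \<phi> =
     quotient_topology (prod_topology F (top_of_set {0..1}))
       {((\<phi> x, 0), (x, 1)) |x. x \<in> topspace F}"

section \<open>Fundamental groups\<close>

text \<open>As for \<^const>\<open>pathin\<close>, only the values of a loop on \<open>{0..1}\<close> matter.\<close>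

definition loops :: "'a topology \<Rightarrow> 'a \<Rightarrow> (real \<Rightarrow> 'a) set" where
  "loops X x = {p. pathin X p \<and> p 0 = x \<and> p 1 = x}"

definition loop_homotopy :: "'a topology \<Rightarrow> 'a \<Rightarrow> ((real \<Rightarrow> 'a) \<times> (real \<Rightarrow> 'a)) set" where
  "loop_homotopy X x =
     {(p, q). p \<in> loops X x \<and> q \<in> loops X x \<and>
        homotopic_with (\<lambda>r. r 0 = x \<and> r 1 = x) (top_of_set {0..1}) X p q}"

definition loop_concat :: "(real \<Rightarrow> 'a) \<Rightarrow> (real \<Rightarrow> 'a) \<Rightarrow> real \<Rightarrow> 'a" where
  "loop_concat p q = (\<lambda>t. if t \<le> 1/2 then p (2 * t) else q (2 * t - 1))"

definition fundamental_group :: "'a topology \<Rightarrow> 'a \<Rightarrow> (real \<Rightarrow> 'a) set monoid" where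
  "fundamental_group X x =
     \<lparr>carrier = loops X x // loop_homotopy X x,
      monoid.mult = (\<lambda>A B. \<Union>p\<in>A. \<Union>q\<in>B. loop_homotopy X x `` {loop_concat p q}),
      one = loop_homotopy X x `` {\<lambda>_. x}\<rparr>"

definition fundamental_group_map ::
    "'b topology \<Rightarrow> 'b \<Rightarrow> ('a \<Rightarrow> 'b) \<Rightarrow> (real \<Rightarrow> 'a) set \<Rightarrow> (real \<Rightarrow> 'b) set" where
  "fundamental_group_map Y y f A = (\<Union>p\<in>A. loop_homotopy Y y `` {f \<circ> p})"

section \<open>Group pairs and their finite quotients\<close>

type_synonym 'g group_pair = "'g monoid \<times> 'g set"

definition pair_iso :: "'g group_pair \<Rightarrow> 'h group_pair \<Rightarrow> bool" where
  "pair_iso P Q \<longleftrightarrow> (\<exists>f\<in>iso (fst P) (fst Q). f ` snd P = snd Q)"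

text \<open>The second component is \<open>HN/N\<close>, the image of \<open>H\<close> under \<open>G \<rightarrow> G/N\<close>.\<close>

definition quotient_pair :: "'g group_pair \<Rightarrow> 'g set \<Rightarrow> 'g set group_pair" where
  "quotient_pair P N = (fst P Mod N, (\<lambda>h. N #>\<^bsub>fst P\<^esub> h) ` snd P)"

definition finite_quotient_pairs :: "'g group_pair \<Rightarrow> 'g set group_pair set" where
  "finite_quotient_pairs P =
     {quotient_pair P N |N. N \<lhd> fst P \<and> finite (rcosets\<^bsub>fst P\<^esub> N)}"

text \<open>Equality of the sets of isomorphism classes, stated through representatives because the
  two sides live in different types.\<close>

definition same_finite_quotients :: "'g group_pair \<Rightarrow> 'h group_pair \<Rightarrow> bool" where
  "same_finite_quotients P Q \<longleftrightarrow>
     (\<forall>A\<in>finite_quotient_pairs P. \<exists>B\<in>finite_quotient_pairs Q. pair_iso A B) \<and>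
     (\<forall>B\<in>finite_quotient_pairs Q. \<exists>A\<in>finite_quotient_pairs P. pair_iso A B)"

text \<open>The peripheral pair of a 3-manifold \<open>M\<close> with connected boundary, based at a point \<open>b\<close> of
  the boundary.\<close>

definition peripheral_pair :: "'a topology \<Rightarrow> 'a \<Rightarrow> (real \<Rightarrow> 'a) set group_pair" where
  "peripheral_pair M b =
     (fundamental_group M b,
      fundamental_group_map M b id `
        carrier (fundamental_group (subtopology M (manifold_boundary 3 M)) b))"

end

theory Submission
  imports Defs "HOL-Algebra.Multiplicative_Group" "HOL-Number_Theory.Cong"
begin

text \<open>
  Let \<open>n\<close> be the order of \<open>\<phi>\<close> and write \<open>M\<^sub>\<psi>\<close> for the mapping torus of \<open>\<psi>\<close>. The torus \<open>M\<^sub>\<phi>\<close> is the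
  quotient of \<open>F \<times> \<real>\<close> by \<open>(x, t) \<mapsto> (\<phi> x, t - 1)\<close>, and translation of \<open>\<real>\<close> descends to a flow on it.
  Flowing for time \<open>u \<ge> 1\<close> from the fibre \<open>t = 0\<close> back to itself is the map \<open>\<phi>\<^sup>u\<close>, so following the
  flow \<open>u\<close> times as fast defines a map \<open>M\<^bsub>\<phi>\<^sup>u\<^esub> \<rightarrow> M\<^sub>\<phi>\<close>, a cyclic covering of degree \<open>u\<close>. A loop of \<open>M\<^sub>\<phi>\<close> lifts to
  \<open>M\<^bsub>\<phi>\<^sup>u\<^esub>\<close> if its winding number around the circle direction is divisible by \<open>u\<close>. Because \<open>\<phi>\<close> has order
  \<open>n\<close>, the torus \<open>M\<^bsub>\<phi>\<^sup>k\<^esub>\<close> equals \<open>M\<^bsub>\<phi>\<^sup>u\<^esub>\<close> for every \<open>u \<equiv> k\<close> modulo \<open>n\<close>, which leaves the choice of \<open>u\<close> open.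

  Let \<open>N\<close> be a normal subgroup of finite index \<open>L\<close> in \<open>\<pi>\<^sub>1(M\<^sub>\<phi>)\<close>. Since \<open>k\<close> is coprime to \<open>n\<close>, there is such a
  \<open>u\<close> that is coprime to \<open>n L\<close> (\<open>exists_coprime_in_residue_class\<close>). The flow line \<open>z\<close> of length \<open>n\<close> is
  closed and has winding number \<open>n\<close>, and \<open>z\<^sup>L\<close> lies in \<open>N\<close>. As its winding number \<open>n L\<close> is invertible
  modulo \<open>u\<close>, every loop of \<open>M\<^sub>\<phi>\<close> can be multiplied by a power of \<open>z\<^sup>L\<close> so that it lifts to \<open>M\<^bsub>\<phi>\<^sup>u\<^esub>\<close>
  (\<open>lift_loop\<close>). Hence \<open>\<pi>\<^sub>1(M\<^bsub>\<phi>\<^sup>k\<^esub>) \<rightarrow> \<pi>\<^sub>1(M\<^sub>\<phi>)/N\<close> is surjective, and \<open>\<pi>\<^sub>1(M\<^sub>\<phi>)/N\<close> is a quotient of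
  \<open>\<pi>\<^sub>1(M\<^bsub>\<phi>\<^sup>k\<^esub>)\<close> as well. The flow preserves the boundary, so for a loop in the boundary the whole
  construction stays in the boundary, and the two peripheral subgroups have the same image
  (\<open>finite_quotient_pair_pullback\<close>, \<open>finite_quotient_of_power\<close>). The other direction is the same
  statement for \<open>\<phi>\<^sup>k\<close>, of which \<open>\<phi>\<close> is a power with exponent coprime to \<open>n\<close>.

  Two geometric facts enter. Paths lift through \<open>F \<times> \<real> \<rightarrow> M\<^sub>\<phi>\<close> (\<open>lift_path\<close>). And the
  boundary of \<open>M\<^sub>\<phi>\<close> is the image of \<open>\<partial>F \<times> \<real>\<close>, by invariance of domain (\<open>q_in_boundary_iff\<close>);
  since \<open>\<partial>F\<close> is a connected 1-manifold, the boundary of \<open>M\<^sub>\<phi>\<close> is path connected, so base points can be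
  moved inside it (\<open>path_connected_boundary_of_M\<close>).
\<close>

section \<open>Homotopies of paths relative to their endpoints\<close>

definition path_homotopic :: "'a topology \<Rightarrow> 'a \<Rightarrow> 'a \<Rightarrow> (real \<Rightarrow> 'a) \<Rightarrow> (real \<Rightarrow> 'a) \<Rightarrow> bool" where
  "path_homotopic X x y p q \<longleftrightarrow>
     homotopic_with (\<lambda>r. r 0 = x \<and> r 1 = y) (top_of_set {0..1}) X p q"

definition reverse_path :: "(real \<Rightarrow> 'a) \<Rightarrow> real \<Rightarrow> 'a" where
  "reverse_path p = (\<lambda>t. p (1 - t))"

lemma path_homotopicI:
  assumes "continuous_map (top_of_set ({0..1} \<times> {0..1} :: (real \<times> real) set)) X h"
    and "\<And>s. s \<in> {0..1} \<Longrightarrow> h (0, s) = p s" "\<And>s. s \<in> {0..1} \<Longrightarrow> h (1, s) = q s"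
    and "\<And>t. t \<in> {0..1} \<Longrightarrow> h (t, 0) = x" "\<And>t. t \<in> {0..1} \<Longrightarrow> h (t, 1) = y"
  shows "path_homotopic X x y p q"
  unfolding path_homotopic_def
  apply (subst homotopic_with)
  subgoal by (simp add: topspace_subtopology)
  using assms by (intro exI[of _ h]) auto

lemma path_homotopicE:
  assumes "path_homotopic X x y p q"
  obtains h where "continuous_map (top_of_set ({0..1} \<times> {0..1} :: (real \<times> real) set)) X h"
    "\<And>s. h (0, s) = p s" "\<And>s. h (1, s) = q s"
    "\<And>t. t \<in> {0..1} \<Longrightarrow> h (t, 0) = x" "\<And>t. t \<in> {0..1} \<Longrightarrow> h (t, 1) = y"
proof -
  obtain h where "continuous_map (top_of_set ({0..1} \<times> {0..1} :: (real \<times> real) set)) X h"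
    "\<forall>s. h (0, s) = p s" "\<forall>s. h (1, s) = q s" "\<forall>t\<in>{0..1}. h (t, 0) = x \<and> h (t, 1) = y"
    using assms unfolding path_homotopic_def homotopic_with_def by auto
  then show thesis using that[of h] by blast
qed

lemma path_homotopic_refl:
  "pathin X p \<Longrightarrow> p 0 = x \<Longrightarrow> p 1 = y \<Longrightarrow> path_homotopic X x y p p"
  by (simp add: path_homotopic_def pathin_def)

lemma path_homotopic_sym: "path_homotopic X x y p q \<Longrightarrow> path_homotopic X x y q p"
  unfolding path_homotopic_def by (rule homotopic_with_symD)

lemma path_homotopic_trans [trans]:
  "path_homotopic X x y p q \<Longrightarrow> path_homotopic X x y q r \<Longrightarrow> path_homotopic X x y p r"
  unfolding path_homotopic_def by (rule homotopic_with_trans)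

lemma path_homotopic_imp_path:
  assumes "path_homotopic X x y p q"
  shows "pathin X p" "p 0 = x" "p 1 = y" "pathin X q" "q 0 = x" "q 1 = y"
  using assms homotopic_with_imp_continuous_maps[of _ _ X p q] homotopic_with_imp_property[of _ _ X p q]
  unfolding path_homotopic_def pathin_def by blast+

lemma path_homotopic_continuous_image:
  assumes "path_homotopic X x y p q" "continuous_map X Y f"
  shows "path_homotopic Y (f x) (f y) (f \<circ> p) (f \<circ> q)"
  using assms unfolding path_homotopic_def
  by (auto intro: homotopic_with_compose_continuous_map_left)

text \<open>Two paths that run through the same map \<open>r\<close> of a convex set of parameters are homotopic
  by a straight line in the parameters. All the laws of the fundamental group that involve no
  second homotopy (associativity, units, inverses, powers of a closed flow line) are instances.\<close>

lemma path_homotopic_reparam: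
  fixes S :: "real set"
  assumes "continuous_map (top_of_set S) X r" "convex S"
    and "continuous_on {0..1} a" "a ` {0..1} \<subseteq> S" "continuous_on {0..1} b" "b ` {0..1} \<subseteq> S"
    and "a 0 = b 0" "a 1 = b 1"
    and p: "\<And>t. t \<in> {0..1} \<Longrightarrow> p t = r (a t)" and q: "\<And>t. t \<in> {0..1} \<Longrightarrow> q t = r (b t)"
    and "p 0 = x" "p 1 = y"
  shows "path_homotopic X x y p q"
proof (rule path_homotopicI)
  let ?l = "\<lambda>(t, s). (1 - t) * a s + t * b s"
  have "continuous_on ({0..1} \<times> {0..1}) ?l"
    unfolding case_prod_unfold
    by (intro continuous_intros continuous_on_compose2[OF assms(3)] continuous_on_compose2[OF assms(5)]) auto
  moreover have "?l ` ({0..1} \<times> {0..1}) \<subseteq> S"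
    using assms(2,4,6) by (force simp: convex_alt image_subset_iff)
  ultimately have "continuous_map (top_of_set ({0..1} \<times> {0..1})) (top_of_set S) ?l"
    by (auto simp: continuous_map_in_subtopology)
  then show "continuous_map (top_of_set ({0..1} \<times> {0..1})) X (r \<circ> ?l)"
    using assms(1) continuous_map_compose by blast
  have "x = r (a 0)" "y = r (a 1)"
    using p[of 0] p[of 1] assms by auto
  then show "(r \<circ> ?l) (t, 0) = x" "(r \<circ> ?l) (t, 1) = y" if "t \<in> {0..1}" for t
    using assms(7,8) by (auto simp: algebra_simps)
qed (auto simp: p q)

lemma path_homotopic_equal:
  assumes "pathin X p" "p 0 = x" "p 1 = y" "\<And>t. t \<in> {0..1} \<Longrightarrow> p t = q t"
  shows "path_homotopic X x y p q"
  using assms by (intro path_homotopic_reparam[of "{0..1}" X p "\<lambda>t. t" "\<lambda>t. t"])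
    (auto simp: pathin_def)

lemma loop_concat_ends [simp]:
  "loop_concat p q 0 = p 0" "loop_concat p q 1 = q 1"
  by (auto simp: loop_concat_def)

lemma pathin_loop_concat:
  assumes "pathin X p" "pathin X q" "p 1 = q 0"
  shows "pathin X (loop_concat p q)"
  unfolding pathin_def loop_concat_def
proof (rule continuous_map_cases_le)
  have half: "continuous_map (top_of_set S) X (\<lambda>t. r (f t))"
    if "pathin X r" "continuous_on S f" "f ` S \<subseteq> {0..1}" for r f and S :: "real set"
  proof -
    have "continuous_map (top_of_set S) (top_of_set {0..1}) f"
      using that by (auto simp: continuous_map_in_subtopology)
    then have "continuous_map (top_of_set S) X (r \<circ> f)"
      using that(1) continuous_map_compose unfolding pathin_def by blast
    then show ?thesis by (simp add: o_def)
  qed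
  show "continuous_map (subtopology (top_of_set {0..1}) {x \<in> topspace (top_of_set {0..1}). x \<le> 1/2})
      X (\<lambda>x. p (2 * x))"
    unfolding subtopology_subtopology
    by (rule half[OF assms(1)]) (auto intro!: continuous_intros)
  show "continuous_map (subtopology (top_of_set {0..1}) {x \<in> topspace (top_of_set {0..1}). 1/2 \<le> x})
      X (\<lambda>x. q (2 * x - 1))"
    unfolding subtopology_subtopology
    by (rule half[OF assms(2)]) (auto intro!: continuous_intros)
  fix t :: real assume "t = 1/2"
  then have "2 * t = 1" "2 * t - 1 = 0" by auto
  then show "p (2 * t) = q (2 * t - 1)" using assms(3) by simp
qed auto

lemma pathin_reverse_path:
  assumes "pathin X p"
  shows "pathin X (reverse_path p)"
proof -
  have "continuous_map (top_of_set {0..1}) (top_of_set {0..1}) (\<lambda>t::real. 1 - t)"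
    by (auto simp: continuous_map_in_subtopology intro!: continuous_intros)
  then have "continuous_map (top_of_set {0..1}) X (p \<circ> (\<lambda>t. 1 - t))"
    using assms continuous_map_compose unfolding pathin_def by blast
  then show ?thesis by (simp add: o_def pathin_def reverse_path_def)
qed

lemma reverse_path_ends [simp]:
  "reverse_path p 0 = p 1" "reverse_path p 1 = p 0"
  by (auto simp: reverse_path_def)

lemma path_homotopic_concat:
  assumes "path_homotopic X x y p p'" "path_homotopic X y z q q'"
  shows "path_homotopic X x z (loop_concat p q) (loop_concat p' q')"
proof -
  obtain h where h: "continuous_map (top_of_set ({0..1} \<times> {0..1} :: (real \<times> real) set)) X h"
    "\<And>s. h (0, s) = p s" "\<And>s. h (1, s) = p' s"
    "\<And>t. t \<in> {0..1} \<Longrightarrow> h (t, 0) = x" "\<And>t. t \<in> {0..1} \<Longrightarrow> h (t, 1) = y"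
    using path_homotopicE[OF assms(1)] by blast
  obtain k where k: "continuous_map (top_of_set ({0..1} \<times> {0..1} :: (real \<times> real) set)) X k"
    "\<And>s. k (0, s) = q s" "\<And>s. k (1, s) = q' s"
    "\<And>t. t \<in> {0..1} \<Longrightarrow> k (t, 0) = y" "\<And>t. t \<in> {0..1} \<Longrightarrow> k (t, 1) = z"
    using path_homotopicE[OF assms(2)] by blast
  let ?Q = "{0..1} \<times> {0..1} :: (real \<times> real) set"
  let ?m = "\<lambda>z :: real \<times> real. if snd z \<le> 1/2 then h (fst z, 2 * snd z) else k (fst z, 2 * snd z - 1)"
  have half: "continuous_map (top_of_set S) X (\<lambda>t. r (f t))"
    if "continuous_map (top_of_set ?Q) X r" "continuous_on S f" "f ` S \<subseteq> ?Q"
    for r f and S :: "(real \<times> real) set"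
  proof -
    have "continuous_map (top_of_set S) (top_of_set ?Q) f"
      using that by (auto simp: continuous_map_in_subtopology)
    then have "continuous_map (top_of_set S) X (r \<circ> f)"
      using that(1) continuous_map_compose by blast
    then show ?thesis by (simp add: o_def)
  qed
  show ?thesis
  proof (rule path_homotopicI[of X ?m])
    show "continuous_map (top_of_set ?Q) X ?m"
    proof (rule continuous_map_cases_le)
      show "continuous_map (subtopology (top_of_set ?Q) {x \<in> topspace (top_of_set ?Q). snd x \<le> 1/2})
          X (\<lambda>z. h (fst z, 2 * snd z))"
        unfolding subtopology_subtopology
        by (rule half[OF h(1)]) (auto intro!: continuous_intros)
      show "continuous_map (subtopology (top_of_set ?Q) {x \<in> topspace (top_of_set ?Q). 1/2 \<le> snd x})
          X (\<lambda>z. k (fst z, 2 * snd z - 1))"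
        unfolding subtopology_subtopology
        by (rule half[OF k(1)]) (auto intro!: continuous_intros)
      fix w assume w: "w \<in> topspace (top_of_set ?Q)" "snd w = 1/2"
      then have "2 * snd w = 1" "2 * snd w - 1 = 0" "fst w \<in> {0..1}" by auto
      then show "h (fst w, 2 * snd w) = k (fst w, 2 * snd w - 1)"
        using h(5) k(4) by simp
    qed (auto intro!: continuous_intros)
  qed (auto simp: loop_concat_def h k)
qed

lemma path_homotopic_assoc:
  assumes "pathin X p" "pathin X q" "pathin X r" "p 1 = q 0" "q 1 = r 0" "p 0 = x" "r 1 = y"
  shows "path_homotopic X x y (loop_concat (loop_concat p q) r) (loop_concat p (loop_concat q r))"
proof -
  \<comment> \<open>The slopes 2, 1, 1/2 of the change of parameter on \<open>[0, 1/4]\<close>, \<open>[1/4, 1/2]\<close>, \<open>[1/2, 1]\<close> decrease,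
      so it is the minimum of its three linear pieces.\<close>
  let ?\<theta> = "\<lambda>t::real. min (2 * t) (min (t + 1/4) (t/2 + 1/2))"
  have "pathin X (loop_concat p (loop_concat q r))"
    using assms by (intro pathin_loop_concat) auto
  then show ?thesis
    unfolding pathin_def
  proof (rule path_homotopic_reparam[where a = ?\<theta> and b = "\<lambda>t. t"])
    fix t :: real assume "t \<in> {0..1}"
    consider "t \<le> 1/4" | "1/4 < t" "t \<le> 1/2" | "1/2 < t" by linarith
    then show "loop_concat (loop_concat p q) r t = loop_concat p (loop_concat q r) (?\<theta> t)"
    proof cases
      case 1
      then have "?\<theta> t = 2 * t" by auto
      then show ?thesis using 1 by (simp add: loop_concat_def)
    next
      case 2
      then have "?\<theta> t = t + 1/4" by auto
      then show ?thesis using 2 by (simp add: loop_concat_def algebra_simps)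
    next
      case 3
      then have "?\<theta> t = t/2 + 1/2" by auto
      then show ?thesis using 3 by (simp add: loop_concat_def algebra_simps)
    qed
  qed (use assms in \<open>auto intro!: continuous_intros\<close>)
qed

lemma path_homotopic_unit_left:
  assumes "pathin X p" "p 0 = x" "p 1 = y"
  shows "path_homotopic X x y (loop_concat (\<lambda>_. x) p) p"
  using assms unfolding pathin_def
  by (intro path_homotopic_reparam[of _ X p "\<lambda>t. max 0 (2 * t - 1)" "\<lambda>t. t"])
     (auto intro!: continuous_intros simp: loop_concat_def)

lemma path_homotopic_unit_right:
  assumes "pathin X p" "p 0 = x" "p 1 = y"
  shows "path_homotopic X x y (loop_concat p (\<lambda>_. y)) p"
  using assms unfolding pathin_def
  by (intro path_homotopic_reparam[of _ X p "\<lambda>t. min (2 * t) 1" "\<lambda>t. t"])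
     (auto intro!: continuous_intros simp: loop_concat_def)

lemma path_homotopic_inverse_right:
  assumes "pathin X p" "p 0 = x" "p 1 = y"
  shows "path_homotopic X x x (loop_concat p (reverse_path p)) (\<lambda>_. x)"
  using assms unfolding pathin_def
  by (intro path_homotopic_reparam[of _ X p "\<lambda>t. min (2 * t) (2 - 2 * t)" "\<lambda>t. 0"])
     (auto intro!: continuous_intros arg_cong[of _ _ p] simp: loop_concat_def reverse_path_def)

lemma path_homotopic_inverse_left:
  assumes "pathin X p" "p 0 = x" "p 1 = y"
  shows "path_homotopic X y y (loop_concat (reverse_path p) p) (\<lambda>_. y)"
  using path_homotopic_inverse_right[OF pathin_reverse_path[OF assms(1)], of y x] assms
  by (simp add: reverse_path_def)

section \<open>The fundamental group\<close>

definition loop_class :: "'a topology \<Rightarrow> 'a \<Rightarrow> (real \<Rightarrow> 'a) \<Rightarrow> (real \<Rightarrow> 'a) set" where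
  "loop_class X x p = loop_homotopy X x `` {p}"

lemma loop_homotopy_iff: "(p, q) \<in> loop_homotopy X x \<longleftrightarrow> path_homotopic X x x p q"
  using path_homotopic_imp_path[of X x x p q]
  unfolding loop_homotopy_def loops_def path_homotopic_def by auto

lemma equiv_loop_homotopy: "equiv (loops X x) (loop_homotopy X x)"
proof (rule equivI)
  show "loop_homotopy X x \<subseteq> loops X x \<times> loops X x"
    by (auto simp: loop_homotopy_def)
  show "refl_on (loops X x) (loop_homotopy X x)"
    by (auto simp: refl_on_def loop_homotopy_iff loops_def intro: path_homotopic_refl)
  show "sym (loop_homotopy X x)"
    by (auto simp: sym_def loop_homotopy_iff intro: path_homotopic_sym)
  show "trans (loop_homotopy X x)"
    by (auto simp: trans_def loop_homotopy_iff intro: path_homotopic_trans)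
qed

lemma loop_class_eqI: "path_homotopic X x x p q \<Longrightarrow> loop_class X x p = loop_class X x q"
  unfolding loop_class_def by (rule equiv_class_eq[OF equiv_loop_homotopy]) (simp add: loop_homotopy_iff)

lemma mem_loop_class: "q \<in> loop_class X x p \<longleftrightarrow> path_homotopic X x x p q"
  by (simp add: loop_class_def loop_homotopy_iff)

lemma loop_class_self: "p \<in> loops X x \<Longrightarrow> p \<in> loop_class X x p"
  by (auto simp: mem_loop_class loops_def intro: path_homotopic_refl)

lemma carrier_fundamental_group: "carrier (fundamental_group X x) = loop_class X x ` loops X x"
  by (auto simp: fundamental_group_def quotient_def loop_class_def)

text \<open>Products, induced maps and base changes of classes are unions over all representatives; this
  evaluates them at one.\<close>

lemma UN_loop_class:
  assumes "p \<in> loops X x" "\<And>q. path_homotopic X x x p q \<Longrightarrow> f q = f p"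
  shows "(\<Union>q\<in>loop_class X x p. f q) = f p"
proof -
  have "f q = f p" if "q \<in> loop_class X x p" for q
    using assms(2) that unfolding mem_loop_class .
  then show ?thesis using loop_class_self[OF assms(1)] by blast
qed

lemma one_fundamental_group: "\<one>\<^bsub>fundamental_group X x\<^esub> = loop_class X x (\<lambda>_. x)"
  by (simp add: fundamental_group_def loop_class_def)

lemma loop_concat_in_loops: "p \<in> loops X x \<Longrightarrow> q \<in> loops X x \<Longrightarrow> loop_concat p q \<in> loops X x"
  by (auto simp: loops_def intro: pathin_loop_concat)

lemma mult_fundamental_group:
  assumes "p \<in> loops X x" "q \<in> loops X x"
  shows "loop_class X x p \<otimes>\<^bsub>fundamental_group X x\<^esub> loop_class X x q = loop_class X x (loop_concat p q)"
proof -
  have eq: "loop_class X x (loop_concat p' q') = loop_class X x (loop_concat p q)"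
    if "path_homotopic X x x p p'" "path_homotopic X x x q q'" for p' q'
    using that by (intro loop_class_eqI path_homotopic_sym[OF path_homotopic_concat])
  have refl: "path_homotopic X x x p p" "path_homotopic X x x q q"
    using assms by (auto simp: loops_def intro: path_homotopic_refl)
  have inner: "(\<Union>q'\<in>loop_class X x q. loop_class X x (loop_concat p' q')) = loop_class X x (loop_concat p q)"
    if "path_homotopic X x x p p'" for p'
  proof -
    have "(\<Union>q'\<in>loop_class X x q. loop_class X x (loop_concat p' q')) = loop_class X x (loop_concat p' q)"
      by (rule UN_loop_class[OF assms(2)]) (rule trans[OF eq[OF that] eq[OF that refl(2), symmetric]])
    also have "\<dots> = loop_class X x (loop_concat p q)"
      by (rule eq[OF that refl(2)])
    finally show ?thesis .
  qed
  have "(\<Union>p'\<in>loop_class X x p. \<Union>q'\<in>loop_class X x q. loop_class X x (loop_concat p' q'))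
      = (\<Union>q'\<in>loop_class X x q. loop_class X x (loop_concat p q'))"
    by (rule UN_loop_class[OF assms(1)]) (rule trans[OF inner inner[OF refl(1), symmetric]])
  also have "\<dots> = loop_class X x (loop_concat p q)"
    by (rule inner[OF refl(1)])
  finally have "(\<Union>p'\<in>loop_class X x p. \<Union>q'\<in>loop_class X x q. loop_class X x (loop_concat p' q'))
      = loop_class X x (loop_concat p q)" .
  then show ?thesis by (simp add: fundamental_group_def loop_class_def)
qed

lemma group_fundamental_group:
  assumes "x \<in> topspace X"
  shows "group (fundamental_group X x)"
proof (rule groupI)
  let ?G = "fundamental_group X x"
  have c: "(\<lambda>_. x) \<in> loops X x" using assms by (simp add: loops_def)
  show "\<one>\<^bsub>?G\<^esub> \<in> carrier ?G"
    using c by (auto simp: carrier_fundamental_group one_fundamental_group)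
  fix A assume "A \<in> carrier ?G"
  then obtain p where p: "p \<in> loops X x" "A = loop_class X x p"
    by (auto simp: carrier_fundamental_group)
  then have p': "pathin X p" "p 0 = x" "p 1 = x" by (auto simp: loops_def)
  show "\<one>\<^bsub>?G\<^esub> \<otimes>\<^bsub>?G\<^esub> A = A"
    using p c p' by (simp add: one_fundamental_group mult_fundamental_group
        loop_class_eqI path_homotopic_unit_left)
  have "reverse_path p \<in> loops X x"
    using p' by (auto simp: loops_def pathin_reverse_path)
  then show "\<exists>B\<in>carrier ?G. B \<otimes>\<^bsub>?G\<^esub> A = \<one>\<^bsub>?G\<^esub>"
    using p p' by (auto simp: carrier_fundamental_group one_fundamental_group mult_fundamental_group
        intro!: bexI[of _ "loop_class X x (reverse_path p)"] loop_class_eqI path_homotopic_inverse_left)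
  fix B assume "B \<in> carrier ?G"
  then obtain q where q: "q \<in> loops X x" "B = loop_class X x q"
    by (auto simp: carrier_fundamental_group)
  show "A \<otimes>\<^bsub>?G\<^esub> B \<in> carrier ?G"
    using p q by (simp add: carrier_fundamental_group mult_fundamental_group loop_concat_in_loops)
  fix C assume "C \<in> carrier ?G"
  then obtain r where r: "r \<in> loops X x" "C = loop_class X x r"
    by (auto simp: carrier_fundamental_group)
  have "loop_class X x (loop_concat (loop_concat p q) r) = loop_class X x (loop_concat p (loop_concat q r))"
    using p q r by (intro loop_class_eqI path_homotopic_assoc) (auto simp: loops_def)
  then show "A \<otimes>\<^bsub>?G\<^esub> B \<otimes>\<^bsub>?G\<^esub> C = A \<otimes>\<^bsub>?G\<^esub> (B \<otimes>\<^bsub>?G\<^esub> C)"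
    using p q r by (simp add: mult_fundamental_group loop_concat_in_loops)
qed

lemma fundamental_group_map_loop_class:
  assumes "continuous_map X Y f" "p \<in> loops X x"
  shows "fundamental_group_map Y (f x) f (loop_class X x p) = loop_class Y (f x) (f \<circ> p)"
  unfolding fundamental_group_map_def loop_class_def[of Y, symmetric]
  using assms by (intro UN_loop_class)
    (auto intro!: loop_class_eqI path_homotopic_continuous_image dest: path_homotopic_sym)

lemma comp_in_loops: "continuous_map X Y f \<Longrightarrow> p \<in> loops X x \<Longrightarrow> f \<circ> p \<in> loops Y (f x)"
  by (auto simp: loops_def pathin_compose)

lemma comp_loop_concat: "f \<circ> loop_concat p q = loop_concat (f \<circ> p) (f \<circ> q)"
  by (auto simp: loop_concat_def fun_eq_iff)

lemma fundamental_group_map_hom: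
  assumes "continuous_map X Y f"
  shows "fundamental_group_map Y (f x) f \<in> hom (fundamental_group X x) (fundamental_group Y (f x))"
  using assms
  by (auto simp: hom_def carrier_fundamental_group fundamental_group_map_loop_class
      mult_fundamental_group comp_in_loops loop_concat_in_loops comp_loop_concat)

section \<open>Change of base point\<close>

definition conjugate_loop :: "(real \<Rightarrow> 'a) \<Rightarrow> (real \<Rightarrow> 'a) \<Rightarrow> real \<Rightarrow> 'a" where
  "conjugate_loop d p = loop_concat (reverse_path d) (loop_concat p d)"

definition base_change :: "'a topology \<Rightarrow> (real \<Rightarrow> 'a) \<Rightarrow> (real \<Rightarrow> 'a) set \<Rightarrow> (real \<Rightarrow> 'a) set" where
  "base_change X d A = (\<Union>p\<in>A. loop_class X (d 1) (conjugate_loop d p))"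

lemma conjugate_loop_in_loops:
  assumes "pathin X d" "p \<in> loops X (d 0)"
  shows "conjugate_loop d p \<in> loops X (d 1)"
  using assms by (auto simp: loops_def conjugate_loop_def intro!: pathin_loop_concat pathin_reverse_path)

lemma base_change_loop_class:
  assumes "pathin X d" "p \<in> loops X (d 0)"
  shows "base_change X d (loop_class X (d 0) p) = loop_class X (d 1) (conjugate_loop d p)"
  unfolding base_change_def
proof (rule UN_loop_class[OF assms(2)])
  fix q assume "path_homotopic X (d 0) (d 0) p q"
  then have "path_homotopic X (d 1) (d 1) (conjugate_loop d q) (conjugate_loop d p)"
    unfolding conjugate_loop_def using assms
    by (intro path_homotopic_concat[of X _ "d 0"] path_homotopic_refl pathin_reverse_path)
       (auto intro: path_homotopic_sym)
  then show "loop_class X (d 1) (conjugate_loop d q) = loop_class X (d 1) (conjugate_loop d p)"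
    by (rule loop_class_eqI)
qed

text \<open>The path \<open>d\<close> followed by its inverse cancels in the middle.\<close>

lemma conjugate_loop_concat:
  assumes d: "pathin X d" and p: "p \<in> loops X (d 0)" and q: "q \<in> loops X (d 0)"
  shows "path_homotopic X (d 1) (d 1) (loop_concat (conjugate_loop d p) (conjugate_loop d q))
           (conjugate_loop d (loop_concat p q))"
proof -
  let ?e = "reverse_path d"
  have pq: "pathin X p" "p 0 = d 0" "p 1 = d 0" "pathin X q" "q 0 = d 0" "q 1 = d 0"
    using p q by (auto simp: loops_def)
  note path = pathin_loop_concat d pathin_reverse_path[OF d] pq
  have "path_homotopic X (d 1) (d 1) (loop_concat (conjugate_loop d p) (conjugate_loop d q))
      (loop_concat ?e (loop_concat (loop_concat p d) (loop_concat ?e (loop_concat q d))))"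
    unfolding conjugate_loop_def by (intro path_homotopic_assoc path) (simp_all add: pq)
  also have "path_homotopic X (d 1) (d 1) \<dots>
      (loop_concat ?e (loop_concat p (loop_concat d (loop_concat ?e (loop_concat q d)))))"
    by (intro path_homotopic_concat[of X _ "d 0"] path_homotopic_refl path_homotopic_assoc path) (simp_all add: pq)
  also have "path_homotopic X (d 1) (d 1) \<dots>
      (loop_concat ?e (loop_concat p (loop_concat (loop_concat d ?e) (loop_concat q d))))"
    by (intro path_homotopic_concat[of X _ "d 0"] path_homotopic_refl path_homotopic_sym[OF path_homotopic_assoc] path)
       (simp_all add: pq)
  also have "path_homotopic X (d 1) (d 1) \<dots>
      (loop_concat ?e (loop_concat p (loop_concat (\<lambda>_. d 0) (loop_concat q d))))"
    by (intro path_homotopic_concat[of X _ "d 0"] path_homotopic_refl path_homotopic_inverse_right path)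
       (simp_all add: pq)
  also have "path_homotopic X (d 1) (d 1) \<dots> (loop_concat ?e (loop_concat p (loop_concat q d)))"
    by (intro path_homotopic_concat[of X _ "d 0"] path_homotopic_refl path_homotopic_unit_left path)
       (simp_all add: pq)
  also have "path_homotopic X (d 1) (d 1) \<dots> (conjugate_loop d (loop_concat p q))"
    unfolding conjugate_loop_def
    by (intro path_homotopic_concat[of X _ "d 0"] path_homotopic_refl path_homotopic_sym[OF path_homotopic_assoc] path)
       (simp_all add: pq)
  finally show ?thesis .
qed

lemma base_change_hom:
  assumes "pathin X d"
  shows "base_change X d \<in> hom (fundamental_group X (d 0)) (fundamental_group X (d 1))"
  using assms
  by (auto simp: hom_def carrier_fundamental_group base_change_loop_class conjugate_loop_in_loops
      mult_fundamental_group loop_concat_in_loops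
      intro!: loop_class_eqI path_homotopic_sym[OF conjugate_loop_concat])

text \<open>This makes \<^term>\<open>base_change X d\<close> surjective, with an explicit preimage that stays in every
  subspace that contains \<open>d\<close> and the given loop.\<close>

lemma conjugate_loop_reverse:
  assumes d: "pathin X d" and p: "p \<in> loops X (d 1)"
  shows "path_homotopic X (d 1) (d 1) (conjugate_loop d (conjugate_loop (reverse_path d) p)) p"
proof -
  let ?e = "reverse_path d"
  have e: "reverse_path ?e = d" by (simp add: reverse_path_def)
  have p': "pathin X p" "p 0 = d 1" "p 1 = d 1"
    using p by (auto simp: loops_def)
  note path = pathin_loop_concat d pathin_reverse_path[OF d] p'
  have "path_homotopic X (d 1) (d 1) (conjugate_loop d (conjugate_loop ?e p))
     (loop_concat (loop_concat ?e (loop_concat d (loop_concat p ?e))) d)"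
    unfolding conjugate_loop_def e
    by (intro path_homotopic_sym[OF path_homotopic_assoc] path) (simp_all add: p')
  also have "path_homotopic X (d 1) (d 1) \<dots>
     (loop_concat (loop_concat (loop_concat ?e d) (loop_concat p ?e)) d)"
    by (intro path_homotopic_concat[of X _ "d 0"] path_homotopic_refl path_homotopic_sym[OF path_homotopic_assoc] path)
       (simp_all add: p')
  also have "path_homotopic X (d 1) (d 1) \<dots> (loop_concat (loop_concat (\<lambda>_. d 1) (loop_concat p ?e)) d)"
    by (intro path_homotopic_concat[of X _ "d 0" _ _ "d 1" d d] path_homotopic_concat[of X _ "d 1" _ _ "d 0"]
        path_homotopic_refl path_homotopic_inverse_left path)
       (simp_all add: p')
  also have "path_homotopic X (d 1) (d 1) \<dots> (loop_concat (loop_concat p ?e) d)"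
    by (intro path_homotopic_concat[of X _ "d 0"] path_homotopic_refl path_homotopic_unit_left path)
       (simp_all add: p')
  also have "path_homotopic X (d 1) (d 1) \<dots> (loop_concat p (loop_concat ?e d))"
    by (intro path_homotopic_assoc path) (simp_all add: p')
  also have "path_homotopic X (d 1) (d 1) \<dots> (loop_concat p (\<lambda>_. d 1))"
    by (intro path_homotopic_concat[of X _ "d 1"] path_homotopic_refl path_homotopic_inverse_left path)
       (simp_all add: p')
  also have "path_homotopic X (d 1) (d 1) \<dots> p"
    by (rule path_homotopic_unit_right[OF p'])
  finally show ?thesis .
qed

section \<open>Closed lines\<close>

text \<open>The parameter path of length \<open>m + 1\<close> and the concatenation of those of lengths \<open>m\<close> and 1 have the
  same endpoints, which gives the induction step. In this form the powers of a closed flow line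
  appear.\<close>

lemma loop_class_periodic_line:
  fixes r :: "real \<Rightarrow> 'a"
  assumes r: "continuous_map euclideanreal X r" and per: "\<And>t. r (t + 1) = r t"
  shows "loop_class X (r 0) (\<lambda>t. r (real m * t)) = loop_class X (r 0) r [^]\<^bsub>fundamental_group X (r 0)\<^esub> m"
proof (induction m)
  case 0
  then show ?case by (simp add: one_fundamental_group)
next
  case (Suc m)
  have per_nat: "r (t + real j) = r t" for t j
  proof (induction j)
    case (Suc j)
    have "r (t + real (Suc j)) = r ((t + real j) + 1)" by (simp add: algebra_simps)
    then show ?case using Suc per by metis
  qed simp
  have path: "pathin X (\<lambda>t. r (c * t))" for c
  proof -
    have "continuous_map (top_of_set {0..1}) euclideanreal (\<lambda>t. c * t)"
      by (auto intro!: continuous_intros)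
    then have "continuous_map (top_of_set {0..1}) X (r \<circ> (\<lambda>t. c * t))"
      using r continuous_map_compose by blast
    then show ?thesis by (simp add: pathin_def o_def)
  qed
  have loop: "(\<lambda>t. r (real j * t)) \<in> loops X (r 0)" for j
    using path[of "real j"] per_nat[of 0 j] by (simp add: loops_def)
  have "loop_class X (r 0) (\<lambda>t. r (real (Suc m) * t))
      = loop_class X (r 0) (loop_concat (\<lambda>t. r (real m * t)) r)"
  proof (intro loop_class_eqI path_homotopic_reparam[of UNIV X r "\<lambda>t. real (Suc m) * t"
          "\<lambda>t. if t \<le> 1/2 then real m * (2 * t) else real m + (2 * t - 1)"])
    show "continuous_on {0..1} (\<lambda>t::real. if t \<le> 1/2 then real m * (2 * t) else real m + (2 * t - 1))"
    proof (rule continuous_on_cases_le)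
      fix t :: real assume "t = 1/2"
      then have "2 * t = 1" by simp
      then show "real m * (2 * t) = real m + (2 * t - 1)" by simp
    qed (auto intro!: continuous_intros)
    show "loop_concat (\<lambda>t. r (real m * t)) r t
        = r (if t \<le> 1/2 then real m * (2 * t) else real m + (2 * t - 1))" for t
      using per_nat[of "2 * t - 1" m] by (auto simp: loop_concat_def add.commute)
    show "r (real (Suc m) * 1) = r 0"
      using per_nat[of 0 "Suc m"] by simp
  qed (use r in \<open>auto intro!: continuous_intros\<close>)
  also have "\<dots> = loop_class X (r 0) (\<lambda>t. r (real m * t)) \<otimes>\<^bsub>fundamental_group X (r 0)\<^esub> loop_class X (r 0) r"
    using loop[of m] loop[of 1] by (simp add: mult_fundamental_group)
  finally show ?case using Suc by simp
qed

section \<open>Interior and boundary points of manifolds\<close>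

lemma open_embedding_homeomorphic_space:
  assumes "continuous_map X Y f" "open_map X Y f" "inj_on f U" "openin X U"
  shows "subtopology X U homeomorphic_space subtopology Y (f ` U)"
proof -
  have U: "topspace (subtopology X U) = U" using openin_subset[OF assms(4)] by auto
  have "embedding_map (subtopology X U) Y f"
  proof (rule injective_open_imp_embedding_map)
    show "continuous_map (subtopology X U) Y f"
      using assms(1) by (rule continuous_map_from_subtopology)
    show "open_map (subtopology X U) Y f"
      unfolding open_map_def
    proof (intro allI impI)
      fix W assume "openin (subtopology X U) W"
      then have "openin X W" using assms(4) openin_open_subtopology by metis
      then show "openin Y (f ` W)" using assms(2) by (simp add: open_map_def)
    qed
  qed (use assms(3) U in simp)
  then show ?thesis
    unfolding embedding_map_def U by (rule homeomorphic_map_imp_homeomorphic_space)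
qed

lemma homeomorphic_onto_open_imp_open_embedding:
  assumes "homeomorphic_map X (subtopology Y V) f" "openin Y V"
  shows "continuous_map X Y f" "open_map X Y f" "inj_on f (topspace X)"
  using assms open_map_from_open_subtopology[OF assms(2)]
  by (auto simp: homeomorphic_eq_everything_map continuous_map_in_subtopology)

lemma homeomorphic_open_subset:
  assumes "subtopology X W homeomorphic_space subtopology E V" "openin E V" "openin X U" "U \<subseteq> W"
  shows "\<exists>V'. openin E V' \<and> subtopology X U homeomorphic_space subtopology E V'"
proof -
  obtain f where f: "homeomorphic_map (subtopology X W) (subtopology E V) f"
    using assms(1) by (auto simp: homeomorphic_space)
  note f' = homeomorphic_onto_open_imp_open_embedding[OF f assms(2)]
  have U: "openin (subtopology X W) U"
    using assms(3,4) by (metis inf.absorb_iff2 openin_subtopology_Int2)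
  then have "inj_on f U"
    using f'(3) openin_subset inj_on_subset by metis
  then have "subtopology (subtopology X W) U homeomorphic_space subtopology E (f ` U)"
    using f' U by (intro open_embedding_homeomorphic_space)
  moreover have "subtopology (subtopology X W) U = subtopology X U"
    using assms(4) by (simp add: subtopology_subtopology inf.absorb2)
  moreover have "openin E (f ` U)" using f'(2) U by (simp add: open_map_def)
  ultimately show ?thesis by auto
qed

text \<open>Being an interior point is a local property, so local homeomorphisms preserve and reflect it.\<close>

lemma manifold_interior_local_homeo:
  assumes f: "continuous_map X Y f" "open_map X Y f" and U: "openin X U" "inj_on f U" "x \<in> U"
  shows "f x \<in> manifold_interior n Y \<longleftrightarrow> x \<in> manifold_interior n X"
proof
  assume "x \<in> manifold_interior n X"
  then obtain W V where W: "openin X W" "x \<in> W" "openin (Euclidean_space n) V"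
    "subtopology X W homeomorphic_space subtopology (Euclidean_space n) V"
    by (auto simp: manifold_interior_def)
  have o: "openin X (U \<inter> W)" using U W by blast
  then obtain V' where V': "openin (Euclidean_space n) V'"
    "subtopology X (U \<inter> W) homeomorphic_space subtopology (Euclidean_space n) V'"
    using homeomorphic_open_subset[OF W(4,3)] by auto
  have "subtopology X (U \<inter> W) homeomorphic_space subtopology Y (f ` (U \<inter> W))"
    using f o U(2) by (intro open_embedding_homeomorphic_space) (auto intro: inj_on_subset)
  then have "subtopology Y (f ` (U \<inter> W)) homeomorphic_space subtopology (Euclidean_space n) V'"
    using V'(2) homeomorphic_space_sym homeomorphic_space_trans by blast
  moreover have "openin Y (f ` (U \<inter> W))" using f(2) o by (simp add: open_map_def)
  ultimately show "f x \<in> manifold_interior n Y"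
    using V'(1) U(3) W(2) openin_subset[of Y "f ` (U \<inter> W)"] unfolding manifold_interior_def by blast
next
  assume "f x \<in> manifold_interior n Y"
  then obtain W V where W: "openin Y W" "f x \<in> W" "openin (Euclidean_space n) V"
    "subtopology Y W homeomorphic_space subtopology (Euclidean_space n) V"
    by (auto simp: manifold_interior_def)
  let ?P = "U \<inter> {z \<in> topspace X. f z \<in> W}"
  have o: "openin X ?P"
    using U(1) openin_continuous_map_preimage[OF f(1) W(1)] by blast
  then have "openin Y (f ` ?P)" using f(2) by (simp add: open_map_def)
  then obtain V' where V': "openin (Euclidean_space n) V'"
    "subtopology Y (f ` ?P) homeomorphic_space subtopology (Euclidean_space n) V'"
    using homeomorphic_open_subset[OF W(4,3), of "f ` ?P"] by blast
  have "subtopology X ?P homeomorphic_space subtopology Y (f ` ?P)"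
    using f o U(2) by (intro open_embedding_homeomorphic_space) (auto intro: inj_on_subset)
  then have "subtopology X ?P homeomorphic_space subtopology (Euclidean_space n) V'"
    using V'(2) homeomorphic_space_trans by blast
  moreover have "x \<in> ?P" using U W openin_subset[OF U(1)] by auto
  ultimately show "x \<in> manifold_interior n X"
    using V'(1) o openin_subset[OF o] unfolding manifold_interior_def by blast
qed

lemma continuous_map_Euclidean_space_iff:
  "continuous_map X (Euclidean_space n) f \<longleftrightarrow>
     (\<forall>i. continuous_map X euclideanreal (\<lambda>x. f x i)) \<and> (\<forall>x\<in>topspace X. \<forall>i\<ge>n. f x i = 0)"
  unfolding Euclidean_space_def continuous_map_in_subtopology continuous_map_componentwise_UNIV
  by auto

lemma continuous_map_Euclidean_space_coord: "continuous_map (Euclidean_space n) euclideanreal (\<lambda>x. x i)"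
  using continuous_map_Euclidean_space_iff[of "Euclidean_space n" n "\<lambda>x. x"] by simp

lemma openin_Euclidean_space_lower_coord:
  assumes "openin (Euclidean_space n) V" "y \<in> V" "n \<ge> 1" "y 0 = 0"
  shows "\<exists>z\<in>V. z 0 < 0"
proof -
  let ?f = "\<lambda>s i. if i = 0 then s else y i"
  have y: "\<forall>i\<ge>n. y i = 0"
    using assms(1,2) openin_subset[of "Euclidean_space n" V] by (auto simp: topspace_Euclidean_space)
  have "continuous_map euclideanreal (Euclidean_space n) ?f"
    using y assms(3) by (simp add: continuous_map_Euclidean_space_iff)
  then have "openin euclideanreal {s \<in> topspace euclideanreal. ?f s \<in> V}"
    using assms(1) openin_continuous_map_preimage by blast
  then have "open {s. ?f s \<in> V}" by simp
  moreover have "?f 0 = y" using assms(4) by (auto simp: fun_eq_iff)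
  then have "0 \<in> {s. ?f s \<in> V}" using assms(2) by simp
  ultimately obtain e where e: "e > 0" "ball 0 e \<subseteq> {s. ?f s \<in> V}"
    using open_contains_ball by blast
  have "- (e / 2) \<in> ball 0 e" using e(1) by simp
  then have "?f (- (e / 2)) \<in> V" using e(2) by blast
  then show ?thesis using e(1) by (intro bexI[of _ "?f (- (e / 2))"]) auto
qed

text \<open>This is where invariance of domain enters: a Euclidean neighbourhood of \<open>x\<close> would be
  mapped by the half-space coordinate onto an open set of Euclidean space that touches the
  hyperplane \<open>y\<^sub>0 = 0\<close> without crossing it.\<close>

lemma half_space_boundary_not_interior:
  assumes U: "openin X U" "x \<in> U" and h: "continuous_map (subtopology X U) (half_space n) h"
    and "inj_on h U" "h x 0 = 0" "n \<ge> 1"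
  shows "x \<notin> manifold_interior n X"
proof
  assume "x \<in> manifold_interior n X"
  then obtain W V where W: "openin X W" "x \<in> W" "openin (Euclidean_space n) V"
    "subtopology X W homeomorphic_space subtopology (Euclidean_space n) V"
    by (auto simp: manifold_interior_def)
  have o: "openin X (U \<inter> W)" using U W by blast
  then obtain V' where V': "openin (Euclidean_space n) V'"
    "subtopology X (U \<inter> W) homeomorphic_space subtopology (Euclidean_space n) V'"
    using homeomorphic_open_subset[OF W(4,3)] by auto
  have t: "topspace (subtopology X (U \<inter> W)) = U \<inter> W" "topspace (subtopology (Euclidean_space n) V') = V'"
    using openin_subset[OF o] openin_subset[OF V'(1)] by auto
  obtain g where g: "homeomorphic_map (subtopology (Euclidean_space n) V') (subtopology X (U \<inter> W)) g"
    using V'(2) homeomorphic_space_sym by (metis homeomorphic_space)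
  then have g': "continuous_map (subtopology (Euclidean_space n) V') (subtopology X (U \<inter> W)) g"
    "g ` V' = U \<inter> W" "inj_on g V'"
    using t by (auto simp: homeomorphic_eq_everything_map)
  have "continuous_map (subtopology X (U \<inter> W)) (half_space n) h"
    using continuous_map_from_subtopology[OF h, of W] by (simp add: subtopology_subtopology)
  then have "continuous_map (subtopology (Euclidean_space n) V') (half_space n) (h \<circ> g)"
    using g'(1) continuous_map_compose by blast
  then have hg: "continuous_map (subtopology (Euclidean_space n) V') (Euclidean_space n) (h \<circ> g)"
    and nonneg: "\<forall>v\<in>V'. 0 \<le> (h \<circ> g) v 0"
    using t by (auto simp: half_space_def continuous_map_in_subtopology)
  have "inj_on (h \<circ> g) V'"
    using g' assms(4) by (intro comp_inj_on) (auto intro: inj_on_subset)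
  then have "openin (Euclidean_space n) ((h \<circ> g) ` V')"
    using invariance_of_domain_Euclidean_space[OF V'(1) hg] by blast
  moreover have "h x \<in> (h \<circ> g) ` V'"
    unfolding image_comp[symmetric] g'(2) using U W by auto
  ultimately obtain z where "z \<in> (h \<circ> g) ` V'" "z 0 < 0"
    using openin_Euclidean_space_lower_coord assms(5,6) by blast
  then show False using nonneg by force
qed

text \<open>A point whose coordinate \<open>y\<^sub>0\<close> in the chart is positive has a Euclidean neighbourhood, and one with
  \<open>y\<^sub>0 = 0\<close> has none by the previous lemma. So the chart tells which points lie in the boundary.\<close>

lemma half_space_chart:
  assumes M: "manifold_with_boundary n X" and x: "x \<in> topspace X" and n: "n \<ge> 1"
  obtains U V h where "openin X U" "x \<in> U" "openin (half_space n) V"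
    "homeomorphic_map (subtopology X U) (subtopology (half_space n) V) h"
    "\<And>y. y \<in> U \<Longrightarrow> y \<in> manifold_boundary n X \<longleftrightarrow> h y 0 = 0"
proof -
  obtain U V where U: "openin X U" "x \<in> U" and V: "openin (half_space n) V"
    and hom: "subtopology X U homeomorphic_space subtopology (half_space n) V"
    using M x unfolding manifold_with_boundary_def by blast
  obtain h where h: "homeomorphic_map (subtopology X U) (subtopology (half_space n) V) h"
    using hom by (auto simp: homeomorphic_space)
  have tU: "topspace (subtopology X U) = U" and tV: "topspace (subtopology (half_space n) V) = V"
    using openin_subset[OF U(1)] openin_subset[OF V] by auto
  have hc: "continuous_map (subtopology X U) (half_space n) h" and inj: "inj_on h U" and img: "h ` U = V"
    using homeomorphic_onto_open_imp_open_embedding[OF h V] h tU tV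
    by (auto simp: homeomorphic_eq_everything_map)
  have "y \<in> manifold_boundary n X \<longleftrightarrow> h y 0 = 0" if y: "y \<in> U" for y
  proof
    assume "h y 0 = 0"
    then have "y \<notin> manifold_interior n X"
      using U(1) y hc inj n by (intro half_space_boundary_not_interior)
    then show "y \<in> manifold_boundary n X"
      using y openin_subset[OF U(1)] by (auto simp: manifold_boundary_def)
  next
    assume bd: "y \<in> manifold_boundary n X"
    show "h y 0 = 0"
    proof (rule ccontr)
      assume "h y 0 \<noteq> 0"
      moreover have "0 \<le> h y 0"
        using y img openin_subset[OF V] by (auto simp: half_space_def)
      ultimately have pos: "h y 0 > 0" by simp
      let ?P = "{z. 0 < z (0::nat)} :: (nat \<Rightarrow> real) set"
      let ?U' = "{z \<in> topspace (subtopology X U). h z \<in> V \<inter> ?P}"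
      obtain V0 where V0: "openin (Euclidean_space n) V0" "V = V0 \<inter> {y. 0 \<le> y 0}"
        using V by (auto simp: half_space_def openin_subtopology)
      have "V \<inter> ?P = V0 \<inter> {z \<in> topspace (Euclidean_space n). z 0 \<in> {0<..}}"
        using V0 openin_subset[OF V0(1)] by auto
      moreover have "openin (Euclidean_space n) {z \<in> topspace (Euclidean_space n). z 0 \<in> {0<..}}"
        by (rule openin_continuous_map_preimage[OF continuous_map_Euclidean_space_coord]) auto
      ultimately have VP: "openin (Euclidean_space n) (V \<inter> ?P)"
        using V0(1) by auto
      have "V \<inter> ?P \<subseteq> {y. 0 \<le> y 0}" by auto
      then have VPh: "openin (half_space n) (V \<inter> ?P)"
        using VP unfolding half_space_def openin_subtopology by blast
      have "openin (subtopology X U) ?U'"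
        using openin_continuous_map_preimage[OF hc VPh] .
      then have oU': "openin X ?U'" using openin_open_subtopology[OF U(1)] by blast
      have "homeomorphic_map (subtopology (subtopology X U) ?U') (subtopology (subtopology (half_space n) V) (V \<inter> ?P)) h"
        by (rule homeomorphic_map_subtopologies_alt[OF h]) auto
      moreover have "subtopology (subtopology X U) ?U' = subtopology X ?U'"
        unfolding subtopology_subtopology by (rule arg_cong[of _ _ "subtopology X"]) (use tU in auto)
      moreover have "subtopology (subtopology (half_space n) V) (V \<inter> ?P) = subtopology (Euclidean_space n) (V \<inter> ?P)"
        unfolding subtopology_subtopology half_space_def
        by (rule arg_cong[of _ _ "subtopology (Euclidean_space n)"]) auto
      ultimately have "homeomorphic_map (subtopology X ?U') (subtopology (Euclidean_space n) (V \<inter> ?P)) h"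
        by (simp only:)
      then have "subtopology X ?U' homeomorphic_space subtopology (Euclidean_space n) (V \<inter> ?P)"
        by (rule homeomorphic_map_imp_homeomorphic_space)
      moreover have "y \<in> ?U'" using y pos img tU by auto
      ultimately have "y \<in> manifold_interior n X"
        using oU' VP openin_subset[OF oU'] unfolding manifold_interior_def by blast
      then show False using bd by (simp add: manifold_boundary_def)
    qed
  qed
  then show thesis using that U V h by blast
qed

lemma connected_locally_path_connected_imp_path_connected:
  assumes "connected_space X"
    and loc: "\<And>x. x \<in> topspace X \<Longrightarrow> \<exists>A. openin X A \<and> x \<in> A \<and> path_connectedin X A"
  shows "path_connected_space X"
proof -
  have reach: "path_component_of X x y" if "path_connectedin X A" "x \<in> A" "y \<in> A" for A x y
    using that path_component_of by metis
  have "path_component_of X x y" if xy: "x \<in> topspace X" "y \<in> topspace X" for x y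
  proof (rule ccontr)
    assume no: "\<not> path_component_of X x y"
    let ?S = "{z \<in> topspace X. path_component_of X x z}" and ?T = "{z \<in> topspace X. \<not> path_component_of X x z}"
    have "openin X ?S"
    proof (subst openin_subopen, safe)
      fix z assume z: "z \<in> topspace X" "path_component_of X x z"
      then obtain A where A: "openin X A" "z \<in> A" "path_connectedin X A" using loc by blast
      have "A \<subseteq> ?S"
      proof
        fix w assume w: "w \<in> A"
        have "path_component_of X x w"
          using path_component_of_trans[OF z(2) reach[OF A(3,2) w]] .
        then show "w \<in> ?S" using w openin_subset[OF A(1)] by blast
      qed
      then show "\<exists>T. openin X T \<and> z \<in> T \<and> T \<subseteq> ?S" using A by blast
    qed
    moreover have "openin X ?T"
    proof (subst openin_subopen, safe)
      fix z assume z: "z \<in> topspace X" "\<not> path_component_of X x z"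
      then obtain A where A: "openin X A" "z \<in> A" "path_connectedin X A" using loc by blast
      have "A \<subseteq> ?T"
      proof
        fix w assume w: "w \<in> A"
        have "\<not> path_component_of X x w"
          using z(2) path_component_of_trans[OF _ reach[OF A(3) w A(2)]] by blast
        then show "w \<in> ?T" using w openin_subset[OF A(1)] by blast
      qed
      then show "\<exists>T. openin X T \<and> z \<in> T \<and> T \<subseteq> ?T" using A by blast
    qed
    moreover have "?S \<inter> ?T = {}" "topspace X \<subseteq> ?S \<union> ?T" by auto
    moreover have "x \<in> ?S" "y \<in> ?T" using xy no path_component_of_refl[of X x] by simp_all
    ultimately show False
      using assms(1) unfolding connected_space_def by blast
  qed
  then show ?thesis
    unfolding path_connected_space_def path_component_of_def by blast
qed

text \<open>In a half-plane chart the boundary is the line \<open>y\<^sub>0 = 0\<close>, and a short open interval of this line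
  is path connected.\<close>

lemma boundary_arc_neighbourhood:
  assumes M: "manifold_with_boundary 2 X" and x: "x \<in> manifold_boundary 2 X"
  shows "\<exists>A. openin (subtopology X (manifold_boundary 2 X)) A \<and> x \<in> A \<and>
           path_connectedin (subtopology X (manifold_boundary 2 X)) A"
proof -
  let ?B = "manifold_boundary 2 X"
  have xX: "x \<in> topspace X" using x by (simp add: manifold_boundary_def)
  obtain U V h where U: "openin X U" "x \<in> U" and V: "openin (half_space 2) V"
    and h: "homeomorphic_map (subtopology X U) (subtopology (half_space 2) V) h"
    and bd: "\<And>y. y \<in> U \<Longrightarrow> y \<in> ?B \<longleftrightarrow> h y 0 = 0"
    using half_space_chart[OF M xX] by auto
  have tU: "topspace (subtopology X U) = U" and tV: "topspace (subtopology (half_space 2) V) = V"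
    using openin_subset[OF U(1)] openin_subset[OF V] by auto
  have hV: "h y \<in> V" if "y \<in> U" for y
    using h tU tV that by (auto simp: homeomorphic_eq_everything_map)
  define line :: "real \<Rightarrow> nat \<Rightarrow> real" where "line s = (\<lambda>i. if i = 1 then s else 0)" for s
  have line: "continuous_map euclideanreal (half_space 2) line"
    unfolding half_space_def continuous_map_in_subtopology continuous_map_Euclidean_space_iff
    by (auto simp: line_def)
  have h_eq: "h y = line (h y 1)" if "y \<in> U" "y \<in> ?B" for y
  proof
    fix i
    have "h y \<in> topspace (Euclidean_space 2)"
      using hV[OF that(1)] openin_subset[OF V] by (auto simp: half_space_def)
    then have "h y i = 0" if "i \<ge> 2" using that by (simp add: topspace_Euclidean_space)
    moreover have "h y 0 = 0" using bd that by blast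
    moreover have "i = 0 \<or> i = 1 \<or> i \<ge> 2" by linarith
    ultimately show "h y i = line (h y 1) i" by (auto simp: line_def)
  qed
  define a where "a = h x 1"
  have "open {s. line s \<in> V}"
    using openin_continuous_map_preimage[OF line V] by simp
  moreover have "a \<in> {s. line s \<in> V}"
    using h_eq[OF U(2) x] hV[OF U(2)] by (simp add: a_def)
  ultimately obtain e where e: "e > 0" "ball a e \<subseteq> {s. line s \<in> V}"
    using open_contains_ball by blast
  define A where "A = {y \<in> U \<inter> ?B. h y 1 \<in> ball a e}"
  have "continuous_map (subtopology X U) (half_space 2) h"
    using homeomorphic_onto_open_imp_open_embedding(1)[OF h V] .
  then have "continuous_map (subtopology X U) (Euclidean_space 2) h"
    by (simp add: half_space_def continuous_map_in_subtopology)
  then have "continuous_map (subtopology X U) euclideanreal (\<lambda>y. h y 1)"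
    unfolding continuous_map_Euclidean_space_iff by blast
  then have "openin (subtopology X U) {y \<in> topspace (subtopology X U). h y 1 \<in> ball a e}"
    by (rule openin_continuous_map_preimage) simp
  then have "openin X {y \<in> U. h y 1 \<in> ball a e}"
    using U(1) openin_open_subtopology tU by metis
  moreover have "A = {y \<in> U. h y 1 \<in> ball a e} \<inter> ?B" by (auto simp: A_def)
  ultimately have oA: "openin (subtopology X ?B) A"
    unfolding openin_subtopology by blast
  obtain g where g: "homeomorphic_maps (subtopology X U) (subtopology (half_space 2) V) h g"
    using h homeomorphic_map_maps by blast
  have "continuous_map (top_of_set (ball a e)) (subtopology (half_space 2) V) line"
    using line e(2) by (auto simp: continuous_map_in_subtopology continuous_map_from_subtopology)
  moreover have "continuous_map (subtopology (half_space 2) V) X g"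
    using g by (auto simp: homeomorphic_maps_def continuous_map_in_subtopology)
  ultimately have "continuous_map (top_of_set (ball a e)) X (g \<circ> line)"
    using continuous_map_compose by blast
  moreover have "path_connectedin (top_of_set (ball a e)) (ball a e)"
    using convex_imp_path_connected[OF convex_ball[of a e]] by (simp add: path_connectedin_subtopology)
  ultimately have "path_connectedin X ((g \<circ> line) ` ball a e)"
    by (rule path_connectedin_continuous_map_image)
  moreover have "(g \<circ> line) ` ball a e = A"
  proof (intro equalityI subsetI)
    fix y assume "y \<in> (g \<circ> line) ` ball a e"
    then obtain s where s: "s \<in> ball a e" "y = g (line s)" by auto
    then have "line s \<in> V" using e(2) by blast
    then have "y \<in> U" "h y = line s"
      using g s(2) tU tV by (auto simp: homeomorphic_maps_def continuous_map_def Pi_iff)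
    then show "y \<in> A" using s(1) bd[of y] by (simp add: A_def line_def)
  next
    fix y assume y: "y \<in> A"
    then have "g (h y) = y" using g tU by (simp add: homeomorphic_maps_def A_def)
    moreover have "h y = line (h y 1)" using y h_eq by (simp add: A_def)
    ultimately have "y = (g \<circ> line) (h y 1)" by simp
    then show "y \<in> (g \<circ> line) ` ball a e" using y by (auto simp: A_def)
  qed
  ultimately have "path_connectedin X A" by simp
  then have "path_connectedin (subtopology X ?B) A"
    by (auto simp: path_connectedin_subtopology A_def)
  moreover have "x \<in> A" using U(2) x e(1) by (simp add: A_def a_def)
  ultimately show ?thesis using oA by blast
qed

lemma path_connected_boundary:
  assumes "manifold_with_boundary 2 X"
    and "card (connected_components_of (subtopology X (manifold_boundary 2 X))) = 1"
  shows "path_connected_space (subtopology X (manifold_boundary 2 X))"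
proof (rule connected_locally_path_connected_imp_path_connected)
  let ?B = "subtopology X (manifold_boundary 2 X)"
  obtain C where C: "connected_components_of ?B = {C}"
    using assms(2) card_1_singletonE by blast
  then have "C = topspace ?B" using Union_connected_components_of[of ?B] by simp
  moreover have "connectedin ?B C" using C connectedin_connected_components_of by blast
  ultimately show "connected_space ?B" using connectedin_topspace by metis
  fix x assume "x \<in> topspace ?B"
  then show "\<exists>A. openin ?B A \<and> x \<in> A \<and> path_connectedin ?B A"
    using boundary_arc_neighbourhood[OF assms(1)] by auto
qed

section \<open>Products with the real line\<close>

lemma homeomorphic_maps_Euclidean_space_times_real:
  "homeomorphic_maps (prod_topology (Euclidean_space n) euclideanreal) (Euclidean_space (Suc n))
     (\<lambda>(y, t). y(n := t)) (\<lambda>z. (z(n := 0), z n))"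
proof -
  have "continuous_map (prod_topology (Euclidean_space n) euclideanreal) euclideanreal (\<lambda>w. (fst w) i)" for i
    using continuous_map_compose[OF continuous_map_fst continuous_map_Euclidean_space_coord] by (simp add: o_def)
  then show ?thesis
    unfolding homeomorphic_maps_def continuous_map_Euclidean_space_iff continuous_map_pairwise
    by (auto simp: case_prod_unfold o_def topspace_Euclidean_space continuous_map_Euclidean_space_coord
        continuous_map_snd fun_eq_iff)
qed

lemma manifold_interior_times_real:
  assumes "x \<in> manifold_interior n X"
  shows "(x, t) \<in> manifold_interior (Suc n) (prod_topology X euclideanreal)"
proof -
  obtain W V where W: "openin X W" "x \<in> W" "openin (Euclidean_space n) V"
    "subtopology X W homeomorphic_space subtopology (Euclidean_space n) V"
    using assms by (auto simp: manifold_interior_def)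
  let ?e = "\<lambda>(y, t::real). y(n := t)"
  have e: "homeomorphic_map (prod_topology (Euclidean_space n) euclideanreal) (Euclidean_space (Suc n)) ?e"
    using homeomorphic_maps_Euclidean_space_times_real homeomorphic_maps_map by blast
  have VR: "openin (prod_topology (Euclidean_space n) euclideanreal) (V \<times> UNIV)"
    using W(3) by (simp add: openin_prod_Times_iff)
  have "prod_topology (subtopology X W) euclideanreal homeomorphic_space
      prod_topology (subtopology (Euclidean_space n) V) euclideanreal"
    using W(4) by (intro homeomorphic_space_prod_topology) auto
  then have "subtopology (prod_topology X euclideanreal) (W \<times> UNIV) homeomorphic_space
      subtopology (prod_topology (Euclidean_space n) euclideanreal) (V \<times> UNIV)"
    by (simp add: prod_topology_subtopology)
  moreover have "subtopology (prod_topology (Euclidean_space n) euclideanreal) (V \<times> UNIV)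
      homeomorphic_space subtopology (Euclidean_space (Suc n)) (?e ` (V \<times> UNIV))"
    using e VR openin_subset[OF VR] unfolding homeomorphic_eq_everything_map
    by (intro open_embedding_homeomorphic_space) (auto intro: inj_on_subset)
  ultimately have "subtopology (prod_topology X euclideanreal) (W \<times> UNIV) homeomorphic_space
      subtopology (Euclidean_space (Suc n)) (?e ` (V \<times> UNIV))"
    using homeomorphic_space_trans by blast
  moreover have "openin (Euclidean_space (Suc n)) (?e ` (V \<times> UNIV))"
    using e VR by (simp add: homeomorphic_eq_everything_map open_map_def)
  moreover have "openin (prod_topology X euclideanreal) (W \<times> UNIV)"
    using W(1) by (simp add: openin_prod_Times_iff)
  ultimately show ?thesis
    using W(2) openin_subset[OF W(1)] unfolding manifold_interior_def by fastforce
qed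

text \<open>If a chart \<open>h\<close> takes \<open>x\<close> to the edge of the half-space, so does \<open>(y, s) \<mapsto> (h y, s)\<close> with \<open>(x, t)\<close>.
  Here \<open>s\<close> is put into coordinate \<open>n\<close>, the first one that the charts of \<open>X\<close> leave free, so
  \<open>n \<ge> 1\<close> keeps it apart from coordinate 0.\<close>

lemma manifold_boundary_times_real:
  assumes "manifold_with_boundary n X" "x \<in> topspace X" "n \<ge> 1"
  shows "(x, t) \<in> manifold_boundary (Suc n) (prod_topology X euclideanreal) \<longleftrightarrow> x \<in> manifold_boundary n X"
proof
  assume "(x, t) \<in> manifold_boundary (Suc n) (prod_topology X euclideanreal)"
  then show "x \<in> manifold_boundary n X"
    using assms(2) manifold_interior_times_real[of x n X t] unfolding manifold_boundary_def by blast
next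
  assume x: "x \<in> manifold_boundary n X"
  obtain U V h where U: "openin X U" "x \<in> U" and V: "openin (half_space n) V"
    and h: "homeomorphic_map (subtopology X U) (subtopology (half_space n) V) h"
    and bd: "\<And>y. y \<in> U \<Longrightarrow> y \<in> manifold_boundary n X \<longleftrightarrow> h y 0 = 0"
    using half_space_chart[OF assms] by auto
  let ?X = "prod_topology X euclideanreal"
  let ?h = "\<lambda>(y, s::real). (h y)(n := s)"
  have tU: "topspace (subtopology X U) = U" using openin_subset[OF U(1)] by auto
  have hc: "continuous_map (subtopology X U) (half_space n) h" and inj: "inj_on h U"
    using homeomorphic_onto_open_imp_open_embedding[OF h V] tU by auto
  have hE: "continuous_map (subtopology X U) (Euclidean_space n) h" and nonneg: "\<forall>y\<in>U. 0 \<le> h y 0"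
    using hc tU by (auto simp: half_space_def continuous_map_in_subtopology)
  have zero: "h y n = 0" if "y \<in> U" for y
    using hE that tU unfolding continuous_map_Euclidean_space_iff by blast
  have "continuous_map (prod_topology (subtopology X U) euclideanreal)
      (prod_topology (Euclidean_space n) euclideanreal) (\<lambda>(y, s). (h y, s))"
    using hE by (intro continuous_map_prod_top[THEN iffD2]) auto
  then have "continuous_map (prod_topology (subtopology X U) euclideanreal) (Euclidean_space (Suc n))
      ((\<lambda>(y, t). y(n := t)) \<circ> (\<lambda>(y, s). (h y, s)))"
    using homeomorphic_maps_Euclidean_space_times_real continuous_map_compose
    unfolding homeomorphic_maps_def by blast
  then have "continuous_map (subtopology ?X (U \<times> UNIV)) (Euclidean_space (Suc n)) ?h"
    by (simp add: o_def case_prod_unfold prod_topology_subtopology)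
  then have "continuous_map (subtopology ?X (U \<times> UNIV)) (half_space (Suc n)) ?h"
    using nonneg assms(3) by (auto simp: half_space_def continuous_map_in_subtopology)
  moreover have "inj_on ?h (U \<times> UNIV)"
  proof (rule inj_onI, clarify)
    fix y s z r assume "y \<in> U" "z \<in> U" and eq: "(h y)(n := s) = (h z)(n := r)"
    have "h y i = h z i" for i
      using fun_cong[OF eq, of i] zero[OF \<open>y \<in> U\<close>] zero[OF \<open>z \<in> U\<close>] by (cases "i = n") simp_all
    then have "h y = h z" by blast
    moreover have "s = r" using fun_cong[OF eq, of n] by simp
    ultimately show "y = z \<and> s = r" using inj \<open>y \<in> U\<close> \<open>z \<in> U\<close> by (auto dest: inj_onD)
  qed
  moreover have "openin ?X (U \<times> UNIV)" using U(1) by (simp add: openin_prod_Times_iff)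
  moreover have "?h (x, t) 0 = 0" using bd[OF U(2)] x assms(3) by simp
  ultimately have "(x, t) \<notin> manifold_interior (Suc n) ?X"
    using U(2) by (intro half_space_boundary_not_interior[of ?X "U \<times> UNIV" "(x, t)" "Suc n" ?h]) auto
  then show "(x, t) \<in> manifold_boundary (Suc n) ?X"
    using assms(2) by (simp add: manifold_boundary_def)
qed

section \<open>The mapping torus of a periodic map\<close>

locale periodic_map =
  fixes F :: "'a topology" and \<phi> :: "'a \<Rightarrow> 'a" and n :: nat
  assumes cont: "continuous_map F F \<phi>"
    and n_pos: "n \<ge> 1"
    and period: "\<And>x. x \<in> topspace F \<Longrightarrow> (\<phi> ^^ n) x = x"
begin

text \<open>Integer powers of \<open>\<phi>\<close>: reducing the exponent modulo the period also covers negative ones.\<close>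

definition act :: "int \<Rightarrow> 'a \<Rightarrow> 'a" where
  "act m = \<phi> ^^ nat (m mod int n)"

lemma funpow_in_topspace: "x \<in> topspace F \<Longrightarrow> (\<phi> ^^ a) x \<in> topspace F"
  by (induction a) (use cont in \<open>auto simp: continuous_map_def\<close>)

lemma act_in_topspace [simp]: "x \<in> topspace F \<Longrightarrow> act m x \<in> topspace F"
  unfolding act_def by (rule funpow_in_topspace)

lemma continuous_map_funpow: "continuous_map F F (\<phi> ^^ a)"
proof (induction a)
  case (Suc a)
  then show ?case unfolding funpow.simps by (rule continuous_map_compose[OF _ cont])
qed simp

lemma continuous_map_act: "continuous_map F F (act m)"
  unfolding act_def by (rule continuous_map_funpow)

lemma act_of_nat: "x \<in> topspace F \<Longrightarrow> act (int a) x = (\<phi> ^^ a) x"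
  using funpow_mod_eq[OF period, of x a] by (simp add: act_def nat_mod_distrib)

lemma act_0 [simp]: "act 0 x = x"
  by (simp add: act_def)

lemma act_1 [simp]: "x \<in> topspace F \<Longrightarrow> act 1 x = \<phi> x"
  using act_of_nat[of x 1] by simp

lemma act_add: "x \<in> topspace F \<Longrightarrow> act (a + b) x = act a (act b x)"
proof -
  assume x: "x \<in> topspace F"
  let ?a = "nat (a mod int n)" and ?b = "nat (b mod int n)"
  have "act a (act b x) = (\<phi> ^^ (?a + ?b)) x"
    by (simp add: act_def funpow_add)
  also have "\<dots> = act (int (?a + ?b)) x"
    by (rule act_of_nat[OF x, symmetric])
  also have "int (?a + ?b) = a mod int n + b mod int n"
    using n_pos by simp
  also have "act \<dots> x = act (a + b) x"
    by (simp add: act_def mod_add_eq)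
  finally show ?thesis by simp
qed

lemma act_period [simp]: "int n dvd m \<Longrightarrow> act m x = x"
  by (simp add: act_def)

lemma act_uminus [simp]: "x \<in> topspace F \<Longrightarrow> act m (act (- m) x) = x" "x \<in> topspace F \<Longrightarrow> act (- m) (act m x) = x"
  using act_add[of x m "- m"] act_add[of x "- m" m] by auto

abbreviation M :: "('a \<times> real) set topology" where
  "M \<equiv> mapping_torus F \<phi>"

abbreviation FR :: "('a \<times> real) topology" where
  "FR \<equiv> prod_topology F euclideanreal"

text \<open>The infinite cyclic covering \<open>F \<times> \<real> \<rightarrow> M\<close> with deck transformations \<open>(x, t) \<mapsto> (\<phi>\<^sup>m x, t - m)\<close>.
  It sends a point to the part of its orbit in \<open>F \<times> [0,1]\<close>, which will turn out to be a class of
  the gluing relation.\<close>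

definition q :: "'a \<times> real \<Rightarrow> ('a \<times> real) set" where
  "q z = {w \<in> topspace F \<times> {0..1}. \<exists>m::int. w = (act m (fst z), snd z - m)}"

lemma q_deck: "x \<in> topspace F \<Longrightarrow> q (act m x, t - of_int m) = q (x, t)"
proof -
  have sub: "q (act m x, t - of_int m) \<subseteq> q (x, t)" if "x \<in> topspace F" for x m and t :: real
  proof
    fix w assume "w \<in> q (act m x, t - of_int m)"
    then obtain k where "w \<in> topspace F \<times> {0..1}" "w = (act k (act m x), t - of_int m - of_int k)"
      by (auto simp: q_def)
    then show "w \<in> q (x, t)"
      using act_add[OF that, of k m] by (auto simp: q_def intro!: exI[of _ "k + m"])
  qed
  assume x: "x \<in> topspace F"
  show ?thesis
    using sub[OF x, of m t] sub[of "act m x" "- m" "t - of_int m"] x by auto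
qed

lemma q_deck': "x \<in> topspace F \<Longrightarrow> q (act m x, t) = q (x, t + of_int m)"
  using q_deck[of x m "t + of_int m"] by simp

lemma q_fundamental_domain: "x \<in> topspace F \<Longrightarrow> (act \<lfloor>t\<rfloor> x, frac t) \<in> q (x, t)"
  by (auto simp: q_def frac_def intro: less_imp_le frac_lt_1 frac_ge_0 simp flip: frac_def)

lemma q_eq_iff:
  assumes "x \<in> topspace F" "y \<in> topspace F"
  shows "q (x, t) = q (y, s) \<longleftrightarrow> (\<exists>m::int. y = act m x \<and> s = t - m)"
proof
  assume "q (x, t) = q (y, s)"
  then have "(act \<lfloor>s\<rfloor> y, frac s) \<in> q (x, t)"
    using q_fundamental_domain assms by blast
  then obtain m where m: "act \<lfloor>s\<rfloor> y = act m x" "frac s = t - of_int m"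
    by (auto simp: q_def)
  then have "y = act (- \<lfloor>s\<rfloor>) (act m x)"
    using assms by (metis act_uminus(2))
  then have "y = act (m - \<lfloor>s\<rfloor>) x"
    using act_add[OF assms(1), of "- \<lfloor>s\<rfloor>" m] by (simp add: algebra_simps)
  then show "\<exists>m::int. y = act m x \<and> s = t - m"
    using m(2) by (intro exI[of _ "m - \<lfloor>s\<rfloor>"]) (simp add: frac_def algebra_simps)
qed (use assms q_deck in auto)

text \<open>Deck transformations other than the identity change the real coordinate by at least 1.\<close>

lemma q_eq_imp_eq:
  assumes "x \<in> topspace F" "y \<in> topspace F" "q (x, t) = q (y, s)" "\<bar>t - s\<bar> < 1"
  shows "x = y \<and> t = s"
proof -
  obtain m :: int where m: "y = act m x" "s = t - m"
    using assms(3) unfolding q_eq_iff[OF assms(1,2)] by blast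
  then have "m = 0" using assms(4) by linarith
  then show ?thesis using m by simp
qed

text \<open>The gluing relation identifies two points of \<open>F \<times> [0,1]\<close> exactly when a deck transformation of
  \<open>F \<times> \<real>\<close> carries one to the other. Thus the points of \<open>M\<close> are literally the values of \<open>q\<close>.\<close>

lemma generated_class_eq_q:
  assumes "x \<in> topspace F" "t \<in> {0..1}"
  shows "generated_equivalence {((\<phi> x, 0), (x, 1)) |x. x \<in> topspace F} `` {(x, t)} = q (x, t)"
    (is "generated_equivalence ?R `` _ = _")
proof
  show "generated_equivalence ?R `` {(x, t)} \<subseteq> q (x, t)"
  proof
    fix w assume "w \<in> generated_equivalence ?R `` {(x, t)}"
    then have "((x, t), w) \<in> (?R \<union> ?R\<inverse>)\<^sup>*" by (simp add: generated_equivalence_def)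
    then show "w \<in> q (x, t)"
    proof (induction rule: rtrancl_induct)
      case base
      show ?case using assms by (auto simp: q_def intro!: exI[of _ 0])
    next
      case (step y z)
      obtain m where m: "y \<in> topspace F \<times> {0..1}" "y = (act m x, t - of_int m)"
        using step.IH by (auto simp: q_def)
      from step.hyps(2) consider
        v where "v \<in> topspace F" "y = (\<phi> v, 0)" "z = (v, 1)" |
        v where "v \<in> topspace F" "y = (v, 1)" "z = (\<phi> v, 0)" by auto
      then show ?case
      proof cases
        case 1
        then have "act (m - 1) x = v"
          using m act_add[OF assms(1), of "- 1" m] act_uminus(2)[of v 1] by simp
        then show ?thesis
          using 1 m by (auto simp: q_def intro!: exI[of _ "m - 1"])
      next
        case 2
        then have "act (1 + m) x = \<phi> v" "\<phi> v \<in> topspace F"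
          using m act_add[OF assms(1), of 1 m] act_in_topspace[of v 1] by auto
        then show ?thesis
          using 2 m by (auto simp: q_def intro!: exI[of _ "1 + m"])
      qed
    qed
  qed
  show "q (x, t) \<subseteq> generated_equivalence ?R `` {(x, t)}"
  proof
    fix w assume "w \<in> q (x, t)"
    then obtain m where m: "w \<in> topspace F \<times> {0..1}" "w = (act m x, t - of_int m)"
      by (auto simp: q_def)
    then have "\<bar>real_of_int m\<bar> \<le> 1" using assms by auto
    then consider "m = 0" | "m = 1" | "m = - 1" by linarith
    then show "w \<in> generated_equivalence ?R `` {(x, t)}"
    proof cases
      case 1
      then show ?thesis using m by (simp add: generated_equivalence_def)
    next
      case 2
      then have "t = 1" "w = (\<phi> x, 0)" using m assms by auto
      then have "((x, t), w) \<in> ?R\<inverse>" using assms by auto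
      then show ?thesis unfolding generated_equivalence_def by blast
    next
      case 3
      then have "t = 0" "w = (act (- 1) x, 1)" using m assms by auto
      moreover have "\<phi> (act (- 1) x) = x"
        using act_uminus(1)[OF assms(1), of 1] act_1[of "act (- 1) x"] assms by simp
      ultimately have "((x, t), w) \<in> ?R"
        using assms by (auto intro!: exI[of _ "act (- 1) x"])
      then show ?thesis unfolding generated_equivalence_def by blast
    qed
  qed
qed

lemma quotient_map_q_unit: "quotient_map (prod_topology F (top_of_set {0..1})) M q"
  using quotient_map_quotient_topology
  unfolding mapping_torus_def
proof (rule quotient_map_eq)
  fix z assume "z \<in> topspace (prod_topology F (top_of_set {0..1::real}))"
  then show "generated_equivalence {((\<phi> x, 0), (x, 1)) |x. x \<in> topspace F} `` {z} = q z"
    using generated_class_eq_q[of "fst z" "snd z"] by (simp add: mem_Times_iff)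
qed

lemma q_unit_representative:
  assumes "x \<in> topspace F"
  obtains y s where "y \<in> topspace F" "s \<in> {0..1}" "q (x, t) = q (y, s)"
  using q_deck[OF assms, of "\<lfloor>t\<rfloor>" t] assms that[of "act \<lfloor>t\<rfloor> x" "frac t"] frac_lt_1[of t]
  by (auto simp: frac_def[symmetric] less_imp_le)

lemma topspace_M: "topspace M = q ` (topspace F \<times> UNIV)"
proof
  have eq: "q ` (topspace F \<times> {0..1}) = topspace M"
    using quotient_imp_surjective_map[OF quotient_map_q_unit] by simp
  then show "topspace M \<subseteq> q ` (topspace F \<times> UNIV)"
    unfolding eq[symmetric] by (intro image_mono) auto
  show "q ` (topspace F \<times> UNIV) \<subseteq> topspace M"
  proof safe
    fix x and t :: real assume "x \<in> topspace F"
    then show "q (x, t) \<in> topspace M"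
      using q_unit_representative[of x t] eq by (metis SigmaI imageI)
  qed
qed

lemma continuous_map_deck:
  "continuous_map FR FR (\<lambda>(x, t). (act m x, t - of_int m))"
  unfolding case_prod_unfold continuous_map_pairwise o_def
  by (auto intro!: continuous_intros continuous_map_compose[OF _ continuous_map_act, unfolded o_def] continuous_map_fst continuous_map_snd)

text \<open>On each slab \<open>F \<times> [i, i + 1]\<close> the map is a deck transformation followed by the defining quotient
  map of \<open>M\<close>, and the slabs form a locally finite closed cover.\<close>

lemma continuous_map_q: "continuous_map FR M q"
proof (rule pasting_lemma_locally_finite[where I = "UNIV :: int set" and f = "\<lambda>_. q"
      and T = "\<lambda>i. topspace F \<times> {real_of_int i..real_of_int i + 1}"])
  fix z assume z: "z \<in> topspace FR"
  let ?V = "topspace F \<times> {snd z - 1<..<snd z + 1}"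
  have "{i \<in> UNIV. topspace F \<times> {real_of_int i..real_of_int i + 1} \<inter> ?V \<noteq> {}} \<subseteq> {\<lfloor>snd z\<rfloor> - 3..\<lfloor>snd z\<rfloor> + 3}"
    by (auto simp: le_floor_iff floor_le_iff) linarith+
  then have "finite {i \<in> UNIV. topspace F \<times> {real_of_int i..real_of_int i + 1} \<inter> ?V \<noteq> {}}"
    using finite_subset by blast
  then show "\<exists>V. openin FR V \<and> z \<in> V
      \<and> finite {i \<in> UNIV. topspace F \<times> {real_of_int i..real_of_int i + 1} \<inter> V \<noteq> {}}"
    using z by (intro exI[of _ ?V]) (auto simp: openin_prod_Times_iff mem_Times_iff)
next
  fix i :: int
  show "closedin FR (topspace F \<times> {real_of_int i..real_of_int i + 1})"
    by (simp add: closedin_prod_Times_iff)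
  let ?d = "\<lambda>(x, t). (act i x, t - of_int i)"
  let ?S = "subtopology FR (topspace F \<times> {real_of_int i..real_of_int i + 1})"
  have "continuous_map ?S (subtopology FR (topspace F \<times> {0..1})) ?d"
    using continuous_map_from_subtopology[OF continuous_map_deck]
    by (auto simp: continuous_map_in_subtopology)
  then have "continuous_map ?S (prod_topology F (top_of_set {0..1})) ?d"
    by (simp add: prod_topology_subtopology)
  then have "continuous_map ?S M (q \<circ> ?d)"
    using continuous_map_compose quotient_imp_continuous_map[OF quotient_map_q_unit] by blast
  then show "continuous_map ?S M q"
    by (rule continuous_map_eq) (auto simp: q_deck)
next
  fix z assume "z \<in> topspace FR"
  then show "\<exists>j. j \<in> UNIV \<and> z \<in> topspace F \<times> {real_of_int j..real_of_int j + 1} \<and> q z = q z"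
    by (intro exI[of _ "\<lfloor>snd z\<rfloor>"]) (auto simp: mem_Times_iff less_imp_le)
qed auto

text \<open>The saturation of an open set is the union of its translates by deck transformations.\<close>

lemma open_map_q: "open_map FR M q"
  unfolding open_map_def
proof (intro allI impI)
  fix W assume W: "openin FR W"
  let ?d = "\<lambda>m (x, t). (act m x, t - real_of_int m)"
  let ?U = "\<Union>m. {z \<in> topspace FR. ?d m z \<in> W}"
  have "openin FR ?U"
    using openin_continuous_map_preimage[OF continuous_map_deck W] by (intro openin_clauses) auto
  then have "openin (subtopology FR (topspace F \<times> {0..1})) (topspace F \<times> {0..1} \<inter> ?U)"
    by (simp add: openin_subtopology_Int2)
  moreover have "topspace F \<times> {0..1} \<inter> ?U = {z \<in> topspace F \<times> {0..1}. q z \<in> q ` W}"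
  proof (intro equalityI subsetI)
    fix z assume "z \<in> topspace F \<times> {0..1} \<inter> ?U"
    then obtain x t m where "z = (x, t)" "x \<in> topspace F" "t \<in> {0..1}" "(act m x, t - real_of_int m) \<in> W" by auto
    then show "z \<in> {z \<in> topspace F \<times> {0..1}. q z \<in> q ` W}"
      using q_deck[of x m t] by (auto intro: image_eqI[of _ _ "(act m x, t - real_of_int m)"])
  next
    fix z assume "z \<in> {z \<in> topspace F \<times> {0..1}. q z \<in> q ` W}"
    then obtain x t y s where z: "z = (x, t)" "x \<in> topspace F" "t \<in> {0..1}" "(y, s) \<in> W" "q (x, t) = q (y, s)" by auto
    moreover have "y \<in> topspace F" using openin_subset[OF W] z(4) by auto
    ultimately obtain m :: int where "y = act m x" "s = t - m" using q_eq_iff by metis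
    then show "z \<in> topspace F \<times> {0..1} \<inter> ?U" using z by auto
  qed
  moreover have "prod_topology F (top_of_set {0..1}) = subtopology FR (topspace F \<times> {0..1})"
    by (simp add: prod_topology_subtopology)
  moreover have "topspace (prod_topology F (top_of_set {0..1::real})) = topspace F \<times> {0..1}"
    by simp
  ultimately have "openin (prod_topology F (top_of_set {0..1})) {z \<in> topspace (prod_topology F (top_of_set {0..1})). q z \<in> q ` W}"
    by (simp only:)
  moreover have "q ` W \<subseteq> topspace M"
    using openin_subset[OF W] by (auto simp: topspace_M)
  ultimately show "openin M (q ` W)"
    using quotient_map_q_unit by (simp add: quotient_map_def)
qed

lemma quotient_map_q: "quotient_map FR M q"
  using continuous_open_imp_quotient_map[OF continuous_map_q open_map_q] topspace_M by simp

lemma continuous_map_flow_line: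
  assumes "x \<in> topspace F" "continuous_on UNIV f"
  shows "continuous_map euclideanreal M (\<lambda>t. q (x, f t))"
proof -
  have "continuous_map euclideanreal FR (\<lambda>t. (x, f t))"
    using assms by (simp add: continuous_map_pairwise o_def)
  then have "continuous_map euclideanreal M (q \<circ> (\<lambda>t. (x, f t)))"
    using continuous_map_q continuous_map_compose by blast
  then show ?thesis by (simp add: o_def)
qed

text \<open>The projection of \<open>M\<close> to the circle. The choice of the representative is immaterial since the
  real coordinates of points in one class differ by integers.\<close>

definition circle_coord :: "('a \<times> real) set \<Rightarrow> complex" where
  "circle_coord A = exp (\<i> * complex_of_real (2 * pi * snd (SOME z. z \<in> A)))"

lemma circle_coord_q:
  assumes "x \<in> topspace F"
  shows "circle_coord (q (x, t)) = exp (\<i> * complex_of_real (2 * pi * t))"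
proof -
  define v where "v = snd (SOME z. z \<in> q (x, t))"
  have "(SOME z. z \<in> q (x, t)) \<in> q (x, t)"
    using q_fundamental_domain[OF assms] by (rule someI)
  moreover have "\<exists>m::int. snd w = t - m" if "w \<in> q (x, t)" for w
    using that by (auto simp: q_def)
  ultimately obtain m :: int where "v = t - m"
    unfolding v_def by blast
  then have t: "t = v + m" by simp
  show ?thesis
    unfolding circle_coord_def v_def[symmetric] unfolding t exp_eq
    by (intro exI[of _ "- m"]) (simp add: algebra_simps)
qed

lemma continuous_map_circle_coord: "continuous_map M euclidean circle_coord"
proof (rule continuous_compose_quotient_map[OF quotient_map_q])
  have "continuous_map FR euclidean ((\<lambda>t. exp (\<i> * complex_of_real (2 * pi * t))) \<circ> snd)"
    by (rule continuous_map_compose[OF continuous_map_snd]) (auto intro!: continuous_intros)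
  then show "continuous_map FR euclidean (circle_coord \<circ> q)"
    by (rule continuous_map_eq) (auto simp: circle_coord_q)
qed

text \<open>Path lifting for \<open>F \<times> \<real> \<rightarrow> M\<close>. A logarithm of the circle coordinate gives the real
  coordinate of the lift; since distinct points of a fibre have real coordinates at distance
  at least 1, it determines the point of \<open>F\<close>, which moves continuously because \<open>q\<close> is open.\<close>

lemma lift_path:
  assumes p: "pathin M p" and x0: "x0 \<in> topspace F" and p0: "p 0 = q (x0, t0)"
  obtains l where "pathin FR l" "l 0 = (x0, t0)" "\<And>s. s \<in> {0..1} \<Longrightarrow> p s = q (l s)"
proof -
  have pM: "p s \<in> topspace M" if "s \<in> {0..1}" for s
    using path_image_subset_topspace[OF p] that by auto
  have "continuous_map (top_of_set {0..1}) euclidean (circle_coord \<circ> p)"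
    using p continuous_map_circle_coord continuous_map_compose unfolding pathin_def by blast
  then have "continuous_on {0..1} (circle_coord \<circ> p)" by simp
  then obtain g where g: "continuous_on {0..1} g" "\<And>s. s \<in> {0..1} \<Longrightarrow> (circle_coord \<circ> p) s = exp (g s)"
    using continuous_logarithm_on_contractible[of "{0..1}" "circle_coord \<circ> p"] convex_imp_contractible[of "{0..1::real}"]
    by (auto simp: circle_coord_def)
  have coord: "\<exists>k::int. Im (g s) / (2 * pi) = t + k"
    if "s \<in> {0..1}" "x \<in> topspace F" "p s = q (x, t)" for s x t
  proof -
    have "exp (g s) = exp (\<i> * complex_of_real (2 * pi * t))"
      using g(2)[OF that(1)] that circle_coord_q by simp
    then obtain k :: int where "g s = \<i> * complex_of_real (2 * pi * t) + (of_int (2 * k) * pi) * \<i>"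
      unfolding exp_eq by blast
    then have "Im (g s) = 2 * pi * (t + k)" by (simp add: algebra_simps)
    then show ?thesis by (intro exI[of _ k]) simp
  qed
  obtain k0 :: int where k0: "Im (g 0) / (2 * pi) = t0 + k0"
    using coord[OF _ x0 p0] by auto
  define \<tau> where "\<tau> s = Im (g s) / (2 * pi) - k0" for s
  have \<tau>: "continuous_on {0..1} \<tau>"
    unfolding \<tau>_def using g(1) by (intro continuous_intros) auto
  have "\<exists>x\<in>topspace F. p s = q (x, \<tau> s)" if s: "s \<in> {0..1}" for s
  proof -
    obtain x t where x: "x \<in> topspace F" "p s = q (x, t)"
      using pM[OF s] topspace_M by auto
    obtain k :: int where "Im (g s) / (2 * pi) = t + k" using coord[OF s x] by blast
    then have "\<tau> s = t - of_int (k0 - k)" by (simp add: \<tau>_def)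
    then have "p s = q (act (k0 - k) x, \<tau> s)" using q_deck[OF x(1), of "k0 - k" t] x(2) by simp
    then show ?thesis using x(1) by (intro bexI[of _ "act (k0 - k) x"]) auto
  qed
  then obtain \<xi> where \<xi>: "\<And>s. s \<in> {0..1} \<Longrightarrow> \<xi> s \<in> topspace F" "\<And>s. s \<in> {0..1} \<Longrightarrow> p s = q (\<xi> s, \<tau> s)"
    by metis
  define l where "l s = (\<xi> s, \<tau> s)" for s
  have "pathin FR l"
    unfolding pathin_def continuous_map_def
  proof (intro conjI allI impI)
    show "l \<in> topspace (top_of_set {0..1}) \<rightarrow> topspace FR"
      using \<xi>(1) by (auto simp: l_def)
    fix W assume W: "openin FR W"
    show "openin (top_of_set {0..1}) {s \<in> topspace (top_of_set {0..1}). l s \<in> W}"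
    proof (subst openin_subopen, safe)
      fix s0 assume s0: "s0 \<in> topspace (top_of_set {0..1::real})" "l s0 \<in> W"
      define I where "I = {\<tau> s0 - 1/2<..<\<tau> s0 + 1/2}"
      let ?W = "W \<inter> (topspace F \<times> I)"
      have "openin FR ?W"
        using W by (auto simp: openin_prod_Times_iff I_def intro: openin_Int)
      then have "openin M (q ` ?W)"
        using open_map_q by (simp add: open_map_def)
      then have "openin (top_of_set {0..1}) {s \<in> topspace (top_of_set {0..1}). p s \<in> q ` ?W}"
        using p openin_continuous_map_preimage unfolding pathin_def by blast
      moreover have "openin (top_of_set {0..1}) {s \<in> topspace (top_of_set {0..1}). \<tau> s \<in> I}"
        using \<tau> by (intro openin_continuous_map_preimage[of _ euclidean]) (auto simp: I_def)
      ultimately have "openin (top_of_set {0..1}) ({s \<in> topspace (top_of_set {0..1}). p s \<in> q ` ?W}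
          \<inter> {s \<in> topspace (top_of_set {0..1}). \<tau> s \<in> I})" (is "openin _ ?N")
        by (rule openin_Int)
      moreover have "s0 \<in> ?N"
      proof -
        have "l s0 \<in> ?W" using s0 \<xi>(1) by (auto simp: l_def I_def)
        moreover have "p s0 = q (l s0)" using s0 \<xi>(2) by (simp add: l_def)
        ultimately show ?thesis using s0 by (auto simp: I_def)
      qed
      moreover have "?N \<subseteq> {s \<in> topspace (top_of_set {0..1}). l s \<in> W}"
      proof
        fix s assume s: "s \<in> ?N"
        then obtain y t where y: "(y, t) \<in> W" "y \<in> topspace F" "t \<in> I" "p s = q (y, t)" by auto
        have s1: "s \<in> {0..1}" "\<tau> s \<in> I" using s by auto
        have "\<bar>\<tau> s - t\<bar> < 1" using y(3) s1(2) by (auto simp: I_def)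
        then have "\<xi> s = y \<and> \<tau> s = t"
          using q_eq_imp_eq[of "\<xi> s" y "\<tau> s" t] \<xi>[OF s1(1)] y by simp
        then show "s \<in> {s \<in> topspace (top_of_set {0..1}). l s \<in> W}"
          using y(1) s1 by (simp add: l_def)
      qed
      ultimately show "\<exists>T. openin (top_of_set {0..1}) T \<and> s0 \<in> T \<and> T \<subseteq> {s \<in> topspace (top_of_set {0..1}). l s \<in> W}"
        by blast
    qed
  qed
  moreover have "l 0 = (x0, t0)"
    using q_eq_imp_eq[of "\<xi> 0" x0 "\<tau> 0" t0] \<xi>[of 0] x0 p0 k0 by (simp add: l_def \<tau>_def)
  moreover have "p s = q (l s)" if "s \<in> {0..1}" for s
    using \<xi>(2)[OF that] by (simp add: l_def)
  ultimately show thesis using that by blast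
qed

end

section \<open>Wrapping a mapping torus around itself\<close>

context periodic_map
begin

lemma act_cong:
  assumes "m mod int n = m' mod int n"
  shows "act m = act m'"
  using assms by (simp add: act_def)

lemma periodic_map_power: "periodic_map F (\<phi> ^^ u) n"
proof
  fix x assume x: "x \<in> topspace F"
  have "((\<phi> ^^ u) ^^ n) x = (\<phi> ^^ (u * n)) x" by (simp add: funpow_mult)
  also have "\<dots> = act (int (u * n)) x" by (rule act_of_nat[OF x, symmetric])
  finally show "((\<phi> ^^ u) ^^ n) x = x" by simp
qed (use n_pos continuous_map_funpow in auto)

lemma act_power:
  assumes x: "x \<in> topspace F"
  shows "periodic_map.act (\<phi> ^^ u) n m x = act (int u * m) x"
proof -
  have "periodic_map.act (\<phi> ^^ u) n m x = (\<phi> ^^ (u * nat (m mod int n))) x"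
    unfolding periodic_map.act_def[OF periodic_map_power] by (simp add: funpow_mult)
  also have "\<dots> = act (int (u * nat (m mod int n))) x"
    by (rule act_of_nat[OF x, symmetric])
  also have "int (u * nat (m mod int n)) = int u * (m mod int n)"
    using n_pos by simp
  also have "act \<dots> = act (int u * m)"
    by (rule act_cong) (simp add: mod_mult_right_eq)
  finally show ?thesis .
qed

text \<open>The flow on \<open>M\<close> that moves along the real direction of \<open>F \<times> \<real>\<close> carries the fibre at
  \<open>t = 0\<close> by time \<open>u\<close> to itself via \<open>\<phi>\<^sup>u\<close>. Following it \<open>u\<close> times as fast thus maps
  the mapping torus of \<open>\<phi>\<^sup>u\<close> to \<open>M\<close>.\<close>

definition flow_map :: "nat \<Rightarrow> ('a \<times> real) set \<Rightarrow> ('a \<times> real) set" where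
  "flow_map u A = (let z = SOME z. z \<in> A in q (fst z, real u * snd z))"

abbreviation q_power :: "nat \<Rightarrow> 'a \<times> real \<Rightarrow> ('a \<times> real) set" where
  "q_power u \<equiv> periodic_map.q F (\<phi> ^^ u) n"

lemma flow_map_q_power:
  assumes "x \<in> topspace F"
  shows "flow_map u (q_power u (x, t)) = q (x, real u * t)"
proof -
  interpret P: periodic_map F "\<phi> ^^ u" n by (rule periodic_map_power)
  define z where "z = (SOME z. z \<in> P.q (x, t))"
  have "z \<in> P.q (x, t)"
    unfolding z_def using P.q_fundamental_domain[OF assms] by (rule someI)
  then obtain m :: int where "z = (P.act m x, t - m)"
    by (auto simp: P.q_def)
  then have z: "z = (act (int u * m) x, t - m)"
    using act_power[OF assms] by simp
  have "flow_map u (P.q (x, t)) = q (act (int u * m) x, real u * t - of_int (int u * m))"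
    unfolding flow_map_def z_def[symmetric] Let_def z by (simp add: algebra_simps)
  also have "\<dots> = q (x, real u * t)"
    by (rule q_deck[OF assms])
  finally show ?thesis .
qed

lemma continuous_map_flow_map: "continuous_map (mapping_torus F (\<phi> ^^ u)) M (flow_map u)"
proof -
  interpret P: periodic_map F "\<phi> ^^ u" n by (rule periodic_map_power)
  show ?thesis
  proof (rule continuous_compose_quotient_map[OF P.quotient_map_q])
    have "continuous_map FR FR (\<lambda>z. (fst z, real u * snd z))"
      unfolding continuous_map_pairwise o_def by (auto intro!: continuous_intros continuous_map_fst continuous_map_snd)
    then have "continuous_map FR M (q \<circ> (\<lambda>z. (fst z, real u * snd z)))"
      using continuous_map_q continuous_map_compose by blast
    then show "continuous_map FR M (flow_map u \<circ> P.q)"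
      by (rule continuous_map_eq) (auto simp: flow_map_q_power)
  qed
qed

section \<open>The boundary torus\<close>

text \<open>The covering \<open>q\<close> is a local homeomorphism, so the boundary can be computed in \<open>F \<times> \<real>\<close>.\<close>

lemma q_in_boundary_iff:
  assumes "manifold_with_boundary 2 F" "x \<in> topspace F"
  shows "q (x, t) \<in> manifold_boundary 3 M \<longleftrightarrow> x \<in> manifold_boundary 2 F"
proof -
  let ?U = "topspace F \<times> {t - 1/2<..<t + 1/2}"
  have "inj_on q ?U"
  proof (rule inj_onI, clarify)
    fix y s z r assume "y \<in> topspace F" "z \<in> topspace F" "s \<in> {t - 1/2<..<t + 1/2}" "r \<in> {t - 1/2<..<t + 1/2}"
      and "q (y, s) = q (z, r)"
    then show "y = z \<and> s = r" by (intro q_eq_imp_eq) auto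
  qed
  moreover have "openin FR ?U" by (simp add: openin_prod_Times_iff)
  ultimately have "q (x, t) \<in> manifold_interior 3 M \<longleftrightarrow> (x, t) \<in> manifold_interior 3 FR"
    using assms(2) by (intro manifold_interior_local_homeo continuous_map_q open_map_q) auto
  moreover have "q (x, t) \<in> topspace M" using assms(2) topspace_M by auto
  ultimately have "q (x, t) \<in> manifold_boundary 3 M \<longleftrightarrow> (x, t) \<in> manifold_boundary 3 FR"
    using assms(2) by (simp add: manifold_boundary_def)
  also have "\<dots> \<longleftrightarrow> x \<in> manifold_boundary 2 F"
    using manifold_boundary_times_real[OF assms, of t] by (simp add: eval_nat_numeral)
  finally show ?thesis .
qed

lemma boundary_of_M_cases:
  assumes "manifold_with_boundary 2 F" "A \<in> manifold_boundary 3 M"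
  obtains x t where "x \<in> topspace F" "x \<in> manifold_boundary 2 F" "A = q (x, t)"
proof -
  have "A \<in> topspace M" using assms(2) by (simp add: manifold_boundary_def)
  then obtain x t where "x \<in> topspace F" "A = q (x, t)" using topspace_M by auto
  then show thesis using that assms q_in_boundary_iff by blast
qed

lemma path_connected_boundary_of_M:
  assumes F: "manifold_with_boundary 2 F"
    and "card (connected_components_of (subtopology F (manifold_boundary 2 F))) = 1"
    and A: "A \<in> manifold_boundary 3 M" and B: "B \<in> manifold_boundary 3 M"
  obtains d where "pathin (subtopology M (manifold_boundary 3 M)) d" "d 0 = A" "d 1 = B"
proof -
  obtain x t where x: "x \<in> topspace F" "x \<in> manifold_boundary 2 F" "A = q (x, t)"
    using boundary_of_M_cases[OF F A] .
  obtain y s where y: "y \<in> topspace F" "y \<in> manifold_boundary 2 F" "B = q (y, s)"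
    using boundary_of_M_cases[OF F B] .
  obtain g where g: "pathin (subtopology F (manifold_boundary 2 F)) g" "g 0 = x" "g 1 = y"
    using path_connected_boundary[OF assms(1,2)] x y unfolding path_connected_space_def by auto
  then have g': "pathin F g" "\<And>r. r \<in> {0..1} \<Longrightarrow> g r \<in> manifold_boundary 2 F"
    by (auto simp: pathin_subtopology)
  define d where "d = q \<circ> (\<lambda>r. (g r, (1 - r) * t + r * s))"
  have "pathin FR (\<lambda>r. (g r, (1 - r) * t + r * s))"
    using g'(1) unfolding pathin_def continuous_map_pairwise o_def by (auto intro!: continuous_intros)
  then have "pathin M d" unfolding d_def using continuous_map_q by (rule pathin_compose)
  moreover have "d r \<in> manifold_boundary 3 M" if "r \<in> {0..1}" for r
    using g'(2)[OF that] q_in_boundary_iff[OF F] by (simp add: d_def manifold_boundary_def[of 2])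
  ultimately have "pathin (subtopology M (manifold_boundary 3 M)) d"
    by (simp add: pathin_subtopology)
  then show thesis using that g x y by (simp add: d_def)
qed

section \<open>Lifting loops to the wrapped mapping torus\<close>

text \<open>A loop in \<open>M\<close> that winds \<open>m\<close> times around the circle lifts through the flow map as soon
  as \<open>u\<close> divides \<open>m\<close>. Appending the closed flow line of length \<open>n\<close>, run through backwards a
  multiple of \<open>L\<close> times, changes \<open>m\<close> by a multiple of \<open>n L\<close> of choice. As \<open>n L\<close> is
  invertible modulo \<open>u\<close>, this can make \<open>m\<close> divisible by \<open>u\<close>.\<close>

lemma lift_loop:
  assumes u: "u \<ge> 1" "coprime u (n * L)" and x0: "x0 \<in> topspace F"
    and \<omega>: "\<omega> \<in> loops M (q (x0, real u * t0))"
  obtains \<omega>' j where "\<omega>' \<in> loops (mapping_torus F (\<phi> ^^ u)) (q_power u (x0, t0))"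
    "\<And>s. s \<in> {0..1} \<Longrightarrow>
       (flow_map u \<circ> \<omega>') s = loop_concat \<omega> (\<lambda>s. q (x0, real u * t0 - real n * (real (j * L) * s))) s"
    "manifold_with_boundary 2 F \<Longrightarrow> x0 \<in> manifold_boundary 2 F \<Longrightarrow>
       \<forall>s\<in>{0..1}. \<omega> s \<in> manifold_boundary 3 M \<Longrightarrow>
       \<forall>s\<in>{0..1}. \<omega>' s \<in> manifold_boundary 3 (mapping_torus F (\<phi> ^^ u))"
proof -
  interpret P: periodic_map F "\<phi> ^^ u" n by (rule periodic_map_power)
  have \<omega>': "pathin M \<omega>" "\<omega> 0 = q (x0, real u * t0)" "\<omega> 1 = q (x0, real u * t0)"
    using \<omega> by (auto simp: loops_def)
  obtain l where l: "pathin FR l" "l 0 = (x0, real u * t0)" "\<And>s. s \<in> {0..1} \<Longrightarrow> \<omega> s = q (l s)"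
    using lift_path[OF \<omega>'(1) x0 \<omega>'(2)] by blast
  define x1 t1 where "x1 = fst (l 1)" and "t1 = snd (l 1)"
  have x1: "x1 \<in> topspace F" "l 1 = (x1, t1)"
    using path_image_subset_topspace[OF l(1)] by (auto simp: x1_def t1_def mem_Times_iff Pi_iff)
  have "q (x1, t1) = q (x0, real u * t0)" using l(3)[of 1] \<omega>'(3) x1(2) by simp
  then obtain m :: int where m: "x0 = act m x1" "real u * t0 = t1 - m"
    unfolding q_eq_iff[OF x1(1) x0] by blast
  obtain j :: nat and e :: int where je: "m - int (j * L * n) = int u * e"
  proof -
    have "coprime (int (n * L)) (int u)"
      using u(2) by (simp add: coprime_commute del: of_nat_mult)
    then obtain i where i: "[int (n * L) * i = 1] (mod int u)"
      using cong_solve_coprime_int by blast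
    define j where "j = nat ((i * m) mod int u)"
    have "int j = (i * m) mod int u" using u(1) by (simp add: j_def)
    then have "[int j = i * m] (mod int u)" by (simp add: cong_def)
    then have "[int (n * L) * int j = int (n * L) * (i * m)] (mod int u)"
      by (rule cong_scalar_left)
    also have "[int (n * L) * (i * m) = 1 * m] (mod int u)"
      using cong_scalar_right[OF i, of m] by (simp add: mult.assoc)
    finally have "[m = int (j * L * n)] (mod int u)"
      by (simp add: cong_sym_eq mult_ac)
    then have "int u dvd m - int (j * L * n)" by (simp add: cong_iff_dvd_diff)
    then show thesis using that by (auto elim: dvdE)
  qed
  \<comment> \<open>The lift of the given loop, continued by a lift of the backward flow line.\<close>
  define \<Lambda> where "\<Lambda> = loop_concat l (\<lambda>s. (x1, t1 - real n * (real (j * L) * s)))"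
  have "pathin FR (\<lambda>s. (x1, t1 - real n * (real (j * L) * s)))"
    using x1(1) unfolding pathin_def continuous_map_pairwise o_def by (auto intro!: continuous_intros)
  then have \<Lambda>: "pathin FR \<Lambda>"
    unfolding \<Lambda>_def using l(1) x1(2) by (intro pathin_loop_concat) auto
  have \<Lambda>F: "fst (\<Lambda> s) \<in> topspace F" if "s \<in> {0..1}" for s
    using path_image_subset_topspace[OF \<Lambda>] that by (auto simp: mem_Times_iff Pi_iff)
  \<comment> \<open>Dividing the height by \<open>u\<close> turns paths below \<open>q\<close> into paths in the wrapped mapping torus.\<close>
  define \<omega>' where "\<omega>' = P.q \<circ> (\<lambda>z. (fst z, snd z / real u)) \<circ> \<Lambda>"
  have flow: "(flow_map u \<circ> \<omega>') s = q (\<Lambda> s)" if "s \<in> {0..1}" for s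
    using flow_map_q_power[OF \<Lambda>F[OF that], of u "snd (\<Lambda> s) / real u"] u(1) by (simp add: \<omega>'_def)
  have concat: "q (\<Lambda> s) = loop_concat \<omega> (\<lambda>s. q (x0, real u * t0 - real n * (real (j * L) * s))) s"
    if "s \<in> {0..1}" for s
  proof -
    have "q (x1, t1 - r) = q (x0, real u * t0 - r)" for r
    proof -
      have "t1 - r - of_int m = real u * t0 - r" using m(2) by simp
      then show ?thesis using q_deck[OF x1(1), of m "t1 - r"] unfolding m(1)[symmetric] by metis
    qed
    then show ?thesis
      using l(3) that by (simp add: \<Lambda>_def loop_concat_def)
  qed
  show thesis
  proof (rule that)
    have "continuous_map FR FR (\<lambda>z. (fst z, snd z / real u))"
      unfolding continuous_map_pairwise o_def
      using u(1) by (auto intro!: continuous_intros continuous_map_fst continuous_map_snd)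
    then have "pathin FR ((\<lambda>z. (fst z, snd z / real u)) \<circ> \<Lambda>)"
      by (rule pathin_compose[OF \<Lambda>])
    then have "pathin P.M (P.q \<circ> ((\<lambda>z. (fst z, snd z / real u)) \<circ> \<Lambda>))"
      using P.continuous_map_q by (rule pathin_compose)
    then have "pathin P.M \<omega>'" by (simp add: \<omega>'_def o_assoc)
    moreover have "\<omega>' 0 = P.q (x0, t0)" using u(1) l(2) by (simp add: \<omega>'_def \<Lambda>_def)
    moreover have "\<omega>' 1 = P.q (x0, t0)"
    proof -
      \<comment> \<open>The total height gained is divisible by \<open>u\<close> and congruent to \<open>m\<close> modulo \<open>n\<close>, so the path closes up.\<close>
      have "t1 - real n * real (j * L) = real u * t0 + of_int (m - int (j * L * n))"
        using m(2) by (simp add: algebra_simps)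
      also have "\<dots> = real u * (t0 + of_int e)" unfolding je by (simp add: algebra_simps)
      finally have "\<omega>' 1 = P.q (x1, t0 + of_int e)"
        using u(1) by (simp add: \<omega>'_def \<Lambda>_def)
      also have "\<dots> = P.q (P.act e x1, t0)" by (rule P.q_deck'[OF x1(1), symmetric])
      also have "P.act e x1 = act (m - int (j * L * n)) x1" unfolding je by (rule act_power[OF x1(1)])
      also have "\<dots> = act m x1"
        by (rule fun_cong[OF act_cong]) (simp add: mod_diff_right_eq[symmetric])
      finally show ?thesis using m(1) by simp
    qed
    ultimately show "\<omega>' \<in> loops P.M (P.q (x0, t0))" by (simp add: loops_def)
  next
    fix s :: real assume "s \<in> {0..1}"
    then show "(flow_map u \<circ> \<omega>') s
        = loop_concat \<omega> (\<lambda>s. q (x0, real u * t0 - real n * (real (j * L) * s))) s"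
      using flow concat by simp
  next
    assume F: "manifold_with_boundary 2 F" and x0B: "x0 \<in> manifold_boundary 2 F"
      and bd: "\<forall>s\<in>{0..1}. \<omega> s \<in> manifold_boundary 3 M"
    show "\<forall>s\<in>{0..1}. \<omega>' s \<in> manifold_boundary 3 P.M"
    proof
      fix s :: real assume s: "s \<in> {0..1}"
      have "q (\<Lambda> s) \<in> manifold_boundary 3 M"
        unfolding concat[OF s] using s bd q_in_boundary_iff[OF F x0] x0B by (simp add: loop_concat_def)
      then have "fst (\<Lambda> s) \<in> manifold_boundary 2 F"
        using q_in_boundary_iff[OF F \<Lambda>F[OF s], of "snd (\<Lambda> s)"] by simp
      then show "\<omega>' s \<in> manifold_boundary 3 P.M"
        using P.q_in_boundary_iff[OF F \<Lambda>F[OF s]] by (simp add: \<omega>'_def)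
    qed
  qed
qed

end

section \<open>Pulling back finite quotients of a group pair\<close>

lemma pair_iso_sym:
  assumes "group (fst P)" "snd P \<subseteq> carrier (fst P)" "pair_iso P Q"
  shows "pair_iso Q P"
proof -
  obtain f where f: "f \<in> iso (fst P) (fst Q)" "f ` snd P = snd Q"
    using assms(3) by (auto simp: pair_iso_def)
  let ?g = "inv_into (carrier (fst P)) f"
  have "?g \<in> iso (fst Q) (fst P)"
    using group.iso_set_sym[OF assms(1) f(1)] .
  moreover have "?g ` snd Q = snd P"
    using f assms(2) inv_into_image_cancel[of f "carrier (fst P)" "snd P"]
    by (auto simp: iso_def bij_betw_def)
  ultimately show ?thesis by (auto simp: pair_iso_def)
qed

text \<open>In \<open>G/N\<close> every element vanishes when raised to the power \<open>|G/N|\<close>. Hence a homomorphism into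
  \<open>G\<close> that is surjective up to such powers becomes surjective onto \<open>G/N\<close>, and \<open>G/N\<close> is also the
  quotient of \<open>G'\<close> by the kernel of the composite. The same condition on the subgroups makes
  their images in this quotient agree.\<close>

lemma finite_quotient_pair_pullback:
  fixes G :: "'g monoid" and G' :: "'h monoid"
  assumes "group G" "group G'" "N \<lhd> G" and fin: "finite (rcosets\<^bsub>G\<^esub> N)"
    and f: "f \<in> hom G' G" and sub: "H \<subseteq> carrier G" "H' \<subseteq> carrier G'" "f ` H' \<subseteq> H"
    and onto: "\<And>g. g \<in> carrier G \<Longrightarrow>
      \<exists>g'\<in>carrier G'. \<exists>x\<in>carrier G. f g' = g \<otimes>\<^bsub>G\<^esub> x [^]\<^bsub>G\<^esub> card (rcosets\<^bsub>G\<^esub> N)"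
    and onto_H: "\<And>g. g \<in> H \<Longrightarrow>
      \<exists>g'\<in>H'. \<exists>x\<in>carrier G. f g' = g \<otimes>\<^bsub>G\<^esub> x [^]\<^bsub>G\<^esub> card (rcosets\<^bsub>G\<^esub> N)"
  shows "\<exists>B\<in>finite_quotient_pairs (G', H'). pair_iso (quotient_pair (G, H) N) B"
proof -
  interpret G: group G by fact
  interpret G': group G' by fact
  interpret N: normal N G by fact
  interpret Q: group "G Mod N" by (rule N.factorgroup_is_group)
  let ?L = "card (rcosets\<^bsub>G\<^esub> N)"
  define \<pi> where "\<pi> g = N #>\<^bsub>G\<^esub> g" for g
  have \<pi>: "\<pi> \<in> hom G (G Mod N)"
    unfolding \<pi>_def by (rule N.r_coset_hom_Mod)
  interpret \<pi>: group_hom G "G Mod N" \<pi>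
    by unfold_locales (rule \<pi>)
  define h where "h = \<pi> \<circ> f"
  have h: "h \<in> hom G' (G Mod N)"
    unfolding h_def using f \<pi> by (rule hom_compose)
  interpret h: group_hom G' "G Mod N" h
    by unfold_locales (rule h)
  have fc: "f g' \<in> carrier G" if "g' \<in> carrier G'" for g'
    using f that by (auto simp: hom_def)
  have carQ: "carrier (G Mod N) = rcosets\<^bsub>G\<^esub> N" by (simp add: FactGroup_def)
  have key: "h g' = \<pi> g"
    if "g' \<in> carrier G'" "g \<in> carrier G" "x \<in> carrier G" "f g' = g \<otimes>\<^bsub>G\<^esub> x [^]\<^bsub>G\<^esub> ?L" for g g' x
  proof -
    have "\<pi> (x [^]\<^bsub>G\<^esub> ?L) = \<pi> x [^]\<^bsub>G Mod N\<^esub> order (G Mod N)"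
      using that by (simp add: \<pi>.hom_nat_pow order_def carQ)
    also have "\<dots> = \<one>\<^bsub>G Mod N\<^esub>"
      using that by (intro Q.pow_order_eq_1) auto
    finally have "\<pi> (x [^]\<^bsub>G\<^esub> ?L) = \<one>\<^bsub>G Mod N\<^esub>" .
    then show ?thesis
      using that Q.r_one[of "\<pi> g"] by (simp add: h_def \<pi>.hom_mult del: one_FactGroup)
  qed
  have h_onto: "h ` carrier G' = carrier (G Mod N)"
  proof
    show "carrier (G Mod N) \<subseteq> h ` carrier G'"
    proof
      fix A assume "A \<in> carrier (G Mod N)"
      then obtain g where "g \<in> carrier G" "A = \<pi> g"
        by (auto simp: carrier_FactGroup \<pi>_def)
      then show "A \<in> h ` carrier G'" using onto[of g] key by blast
    qed
  qed auto
  have h_H: "h ` H' = \<pi> ` H"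
  proof
    show "h ` H' \<subseteq> \<pi> ` H" using sub(3) by (auto simp: h_def)
    show "\<pi> ` H \<subseteq> h ` H'"
    proof
      fix A assume "A \<in> \<pi> ` H"
      then obtain g where "g \<in> H" "A = \<pi> g" by auto
      then show "A \<in> h ` H'" using onto_H[of g] key sub by blast
    qed
  qed
  define N' where "N' = kernel G' (G Mod N) h"
  define \<Phi> where "\<Phi> X = the_elem (h ` X)" for X
  have N': "N' \<lhd> G'"
    unfolding N'_def by (rule h.normal_kernel)
  have \<Phi>: "\<Phi> \<in> iso (G' Mod N') (G Mod N)"
    unfolding \<Phi>_def[abs_def] N'_def using h_onto by (rule h.FactGroup_iso_set)
  have \<Phi>_coset: "\<Phi> (N' #>\<^bsub>G'\<^esub> g) = h g" if "g \<in> carrier G'" for g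
  proof -
    have "h ` (N' #>\<^bsub>G'\<^esub> g) = {h g}"
    proof -
      have "\<one>\<^bsub>G'\<^esub> \<in> N'" by (simp add: N'_def kernel_def)
      then have "h g \<in> h ` (N' #>\<^bsub>G'\<^esub> g)"
        using that by (force simp: r_coset_def)
      moreover have "h y = h g" if "y \<in> N' #>\<^bsub>G'\<^esub> g" for y
        using that \<open>g \<in> carrier G'\<close> h.hom_closed[OF \<open>g \<in> carrier G'\<close>]
        by (auto simp: r_coset_def N'_def kernel_def simp del: one_FactGroup mult_FactGroup)
      ultimately show ?thesis by blast
    qed
    then show ?thesis by (simp add: \<Phi>_def)
  qed
  have "bij_betw \<Phi> (rcosets\<^bsub>G'\<^esub> N') (rcosets\<^bsub>G\<^esub> N)"
    using \<Phi> by (simp add: iso_def FactGroup_def)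
  then have "finite (rcosets\<^bsub>G'\<^esub> N')"
    using fin bij_betw_finite by blast
  then have B: "quotient_pair (G', H') N' \<in> finite_quotient_pairs (G', H')"
    using N' by (auto simp: finite_quotient_pairs_def)
  have "\<Phi> ` ((\<lambda>g. N' #>\<^bsub>G'\<^esub> g) ` H') = \<pi> ` H"
    unfolding image_image h_H[symmetric] using \<Phi>_coset sub(2) by (intro image_cong) auto
  then have "pair_iso (quotient_pair (G', H') N') (quotient_pair (G, H) N)"
    unfolding pair_iso_def quotient_pair_def fst_conv snd_conv \<pi>_def using \<Phi> by (intro bexI[of _ \<Phi>])
  moreover have "group (fst (quotient_pair (G', H') N'))"
    using N' by (simp add: quotient_pair_def normal.factorgroup_is_group)
  moreover have "snd (quotient_pair (G', H') N') \<subseteq> carrier (fst (quotient_pair (G', H') N'))"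
    using sub(2) by (auto simp: quotient_pair_def carrier_FactGroup)
  ultimately have "pair_iso (quotient_pair (G, H) N) (quotient_pair (G', H') N')"
    by (blast intro: pair_iso_sym)
  then show ?thesis using B by blast
qed

section \<open>An arithmetic choice\<close>

text \<open>Adding to \<open>w \<equiv> v\<close> the product of \<open>n\<close> with all prime divisors of \<open>L\<close> that do not divide \<open>w\<close> works:
  a prime divisor of \<open>L\<close> divides exactly one of the two summands. The start value \<open>w = v + n\<close> serves
  to make \<open>u\<close> positive.\<close>

lemma exists_coprime_in_residue_class:
  fixes v n L :: nat
  assumes "coprime v n" "n \<ge> 1" "L \<ge> 1"
  shows "\<exists>u\<ge>1. [u = v] (mod n) \<and> coprime u (n * L)"
proof -
  define w where "w = v + n"
  define t where "t = \<Prod>{p. prime p \<and> p dvd L \<and> \<not> p dvd w}"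
  define u where "u = w + n * t"
  have fin: "finite {p. prime p \<and> p dvd L \<and> \<not> p dvd w}"
    by (rule finite_subset[of _ "{p. p dvd L}"]) (use assms(3) in auto)
  have "w mod n = v mod n" "u mod n = v mod n" by (simp_all add: u_def w_def)
  then have w: "coprime w n" and "coprime u n"
    using assms(1,2) coprime_mod_left_iff[of n] by (metis not_one_le_zero)+
  moreover have "coprime u L"
  proof (rule ccontr)
    assume "\<not> coprime u L"
    then have "gcd u L \<noteq> 1" by (simp add: coprime_iff_gcd_eq_1)
    then obtain p where p: "prime p" "p dvd u" "p dvd L"
      using prime_factor_nat[of "gcd u L"] by auto
    show False
    proof (cases "p dvd w")
      case True
      then have "p dvd n * t" using p(2) by (simp add: u_def dvd_add_right_iff)
      moreover have "\<not> p dvd n" using True w p(1) by (metis coprime_common_divisor_nat not_prime_1)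
      ultimately have "p dvd t" using p(1) prime_dvd_mult_iff by blast
      then obtain p' where "prime p'" "\<not> p' dvd w" "p dvd p'"
        unfolding t_def using prime_dvd_prod_iff[OF fin p(1), of "\<lambda>x. x"] by auto
      then show False using True p(1) primes_dvd_imp_eq by blast
    next
      case False
      then have "p dvd t" unfolding t_def using p fin by (intro dvd_prodI[of _ _ "\<lambda>x. x"]) auto
      then have "p dvd w" using p(2) unfolding u_def by (metis dvd_add_left_iff dvd_mult)
      then show False using False by simp
    qed
  qed
  ultimately have "coprime u (n * L)" by simp
  moreover have "[u = v] (mod n)" by (simp add: u_def w_def cong_def)
  moreover have "u \<ge> 1" using assms(2) by (simp add: u_def w_def)
  ultimately show ?thesis by blast
qed

section \<open>Peripheral pairs\<close>

lemma loops_subtopology: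
  "loops (subtopology X S) x = {p \<in> loops X x. \<forall>s\<in>{0..1}. p s \<in> S}"
  by (auto simp: loops_def pathin_subtopology)

lemma peripheral_pair_eq:
  "peripheral_pair X b = (fundamental_group X b, loop_class X b ` loops (subtopology X (manifold_boundary 3 X)) b)"
proof -
  have "continuous_map (subtopology X (manifold_boundary 3 X)) X id" by simp
  then have "fundamental_group_map X b id (loop_class (subtopology X (manifold_boundary 3 X)) b p) = loop_class X b p"
    if "p \<in> loops (subtopology X (manifold_boundary 3 X)) b" for p
    using fundamental_group_map_loop_class[of _ X id p b] that by simp
  then have "fundamental_group_map X b id ` loop_class (subtopology X (manifold_boundary 3 X)) b ` loops (subtopology X (manifold_boundary 3 X)) b
      = loop_class X b ` loops (subtopology X (manifold_boundary 3 X)) b"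
    unfolding image_image by (intro image_cong) auto
  then show ?thesis by (simp add: peripheral_pair_def carrier_fundamental_group)
qed

lemma mapping_torus_cong:
  assumes "\<And>x. x \<in> topspace F \<Longrightarrow> f x = g x"
  shows "mapping_torus F f = mapping_torus F g"
proof -
  have "{((f x, 0::real), (x, 1::real)) |x. x \<in> topspace F} = {((g x, 0), (x, 1)) |x. x \<in> topspace F}"
    using assms by auto
  then show ?thesis by (simp add: mapping_torus_def)
qed

context periodic_map
begin

text \<open>The index \<open>L\<close> of \<open>N\<close> is fixed first, and only then a number \<open>u \<equiv> v\<close> modulo \<open>n\<close> that is coprime to
  \<open>n L\<close>. The homomorphism \<open>f\<close> is the flow map followed by a change of base point
  along a path \<open>d\<close> in the boundary, which makes it respect the peripheral subgroups.\<close>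

lemma finite_quotient_of_power:
  assumes F: "manifold_with_boundary 2 F"
    and comp: "card (connected_components_of (subtopology F (manifold_boundary 2 F))) = 1"
    and v: "coprime v n"
    and b: "b \<in> manifold_boundary 3 M"
    and b': "b' \<in> manifold_boundary 3 (mapping_torus F (\<phi> ^^ v))"
    and A: "A \<in> finite_quotient_pairs (peripheral_pair M b)"
  shows "\<exists>B\<in>finite_quotient_pairs (peripheral_pair (mapping_torus F (\<phi> ^^ v)) b'). pair_iso A B"
proof -
  let ?G = "fundamental_group M b"
  let ?B = "manifold_boundary 3 M"
  let ?H = "loop_class M b ` loops (subtopology M ?B) b"
  obtain N where N: "A = quotient_pair (?G, ?H) N" "N \<lhd> ?G" and fin: "finite (rcosets\<^bsub>?G\<^esub> N)"
    using A by (auto simp: finite_quotient_pairs_def peripheral_pair_eq)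
  have bM: "b \<in> topspace M" using b by (simp add: manifold_boundary_def)
  interpret G: group ?G by (rule group_fundamental_group[OF bM])
  define L where "L = card (rcosets\<^bsub>?G\<^esub> N)"
  have "rcosets\<^bsub>?G\<^esub> N \<noteq> {}" using G.one_closed by (auto simp: RCOSETS_def)
  then have "L \<ge> 1" using fin by (simp add: L_def Suc_le_eq card_gt_0_iff)
  then obtain u where u: "u \<ge> 1" "[u = v] (mod n)" "coprime u (n * L)"
    using exists_coprime_in_residue_class[OF v n_pos] by blast
  interpret P: periodic_map F "\<phi> ^^ u" n by (rule periodic_map_power)
  have "(\<phi> ^^ v) x = (\<phi> ^^ u) x" if "x \<in> topspace F" for x
    using act_of_nat[OF that, of u] act_of_nat[OF that, of v] act_cong[of "int u" "int v"] u(2)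
    by (simp add: cong_def flip: of_nat_mod)
  then have Mv: "mapping_torus F (\<phi> ^^ v) = P.M" by (rule mapping_torus_cong)
  let ?B' = "manifold_boundary 3 P.M"
  let ?G' = "fundamental_group P.M b'"
  let ?H' = "loop_class P.M b' ` loops (subtopology P.M ?B') b'"
  have b': "b' \<in> ?B'" using b' Mv by simp
  then have bM': "b' \<in> topspace P.M" by (simp add: manifold_boundary_def)
  obtain x0 t0 where x0: "x0 \<in> topspace F" "x0 \<in> manifold_boundary 2 F" "b' = P.q (x0, t0)"
    using P.boundary_of_M_cases[OF F b'] .
  define c where "c = q (x0, real u * t0)"
  have flow_b': "flow_map u b' = c" unfolding x0(3) c_def by (rule flow_map_q_power[OF x0(1)])
  have c: "c \<in> ?B" using q_in_boundary_iff[OF F x0(1)] x0(2) by (simp add: c_def)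
  obtain d where dB: "pathin (subtopology M ?B) d" and d: "d 0 = c" "d 1 = b"
    using path_connected_boundary_of_M[OF F comp c b] .
  have dM: "pathin M d" using dB by (simp add: pathin_subtopology)
  define f where "f = base_change M d \<circ> fundamental_group_map M c (flow_map u)"
  have f_hom: "f \<in> hom ?G' ?G"
    unfolding f_def using fundamental_group_map_hom[OF continuous_map_flow_map, of u b'] base_change_hom[OF dM]
    by (auto simp: flow_b' d intro: hom_compose)
  have f_class: "f (loop_class P.M b' p) = loop_class M b (conjugate_loop d (flow_map u \<circ> p))"
    if "p \<in> loops P.M b'" for p
    using fundamental_group_map_loop_class[OF continuous_map_flow_map that]
      base_change_loop_class[OF dM, of "flow_map u \<circ> p"] comp_in_loops[OF continuous_map_flow_map that]
    by (simp add: f_def flow_b' d)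
  \<comment> \<open>The backward flow line through \<open>c\<close>, scaled so that it closes up after time 1.\<close>
  define r where "r s = q (x0, real u * t0 - real n * s)" for s
  have r0: "r 0 = c" by (simp add: r_def c_def)
  have r: "continuous_map euclideanreal M r"
    unfolding r_def by (intro continuous_map_flow_line x0(1) continuous_intros)
  have r_per: "r (s + 1) = r s" for s
    using q_deck[OF x0(1), of "int n" "real u * t0 - real n * s"] by (simp add: r_def algebra_simps)
  \<comment> \<open>The exponent \<open>L\<close> puts the error term \<open>x [^] L\<close> into \<open>N\<close>.\<close>
  have lift: "\<exists>p\<in>loops P.M b'. \<exists>x\<in>carrier ?G.
      f (loop_class P.M b' p) = loop_class M b \<gamma> \<otimes>\<^bsub>?G\<^esub> x [^]\<^bsub>?G\<^esub> L
      \<and> (\<gamma> \<in> loops (subtopology M ?B) b \<longrightarrow> p \<in> loops (subtopology P.M ?B') b')"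
    if \<gamma>: "\<gamma> \<in> loops M b" for \<gamma>
  proof -
    let ?\<omega> = "conjugate_loop (reverse_path d) \<gamma>"
    have \<omega>: "?\<omega> \<in> loops M c"
      using conjugate_loop_in_loops[OF pathin_reverse_path[OF dM], of \<gamma>] \<gamma> d by simp
    obtain p j where p: "p \<in> loops P.M b'"
      "\<And>s. s \<in> {0..1} \<Longrightarrow> (flow_map u \<circ> p) s
         = loop_concat ?\<omega> (\<lambda>s. q (x0, real u * t0 - real n * (real (j * L) * s))) s"
      and pB: "\<forall>s\<in>{0..1}. ?\<omega> s \<in> ?B \<Longrightarrow> \<forall>s\<in>{0..1}. p s \<in> ?B'"
      using lift_loop[OF u(1,3) x0(1) \<omega>[unfolded c_def]] F x0(2) unfolding x0(3)[symmetric]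
      by metis
    note flow_p = p(2)[folded r_def]
    define g where "g = loop_class M c r"
    have r_loop: "r \<in> loops M c"
      using r continuous_map_from_subtopology[OF r] r_per[of 0] r0 by (simp add: loops_def pathin_def)
    have g: "g \<in> carrier (fundamental_group M c)"
      using r_loop by (simp add: g_def carrier_fundamental_group)
    have line: "loop_class M c (\<lambda>s. r (real (j * L) * s)) = g [^]\<^bsub>fundamental_group M c\<^esub> (j * L)"
      using loop_class_periodic_line[OF r r_per, of "j * L"] unfolding r0 g_def .
    have line_loop: "(\<lambda>s. r (real (j * L) * s)) \<in> loops M c"
    proof -
      have "r (real m) = r 0" for m
      proof (induction m)
        case (Suc m)
        then show ?case using r_per[of "real m"] by (simp add: add.commute)
      qed simp
      moreover have "continuous_map euclideanreal M (r \<circ> (\<lambda>s. real (j * L) * s))"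
        by (rule continuous_map_compose[OF _ r]) (auto intro!: continuous_intros)
      then have "pathin M (\<lambda>s. r (real (j * L) * s))"
        unfolding pathin_def o_def by (rule continuous_map_from_subtopology)
      ultimately show ?thesis using r0 by (simp add: loops_def del: of_nat_mult)
    qed
    interpret Gc: group "fundamental_group M c"
      using c by (intro group_fundamental_group) (simp add: manifold_boundary_def)
    interpret \<beta>: group_hom "fundamental_group M c" ?G "base_change M d"
      using base_change_hom[OF dM] d by unfold_locales simp
    have "path_homotopic M c c (flow_map u \<circ> p) (loop_concat ?\<omega> (\<lambda>s. r (real (j * L) * s)))"
      using comp_in_loops[OF continuous_map_flow_map p(1)] flow_p
      by (intro path_homotopic_equal) (auto simp: loops_def flow_b')
    then have "loop_class M c (flow_map u \<circ> p) = loop_class M c ?\<omega> \<otimes>\<^bsub>fundamental_group M c\<^esub> g [^]\<^bsub>fundamental_group M c\<^esub> (j * L)"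
      using mult_fundamental_group[OF \<omega> line_loop] line by (simp add: loop_class_eqI)
    moreover have "f (loop_class P.M b' p) = base_change M d (loop_class M c (flow_map u \<circ> p))"
      using fundamental_group_map_loop_class[OF continuous_map_flow_map p(1)] by (simp add: f_def flow_b')
    moreover have "loop_class M c ?\<omega> \<in> carrier (fundamental_group M c)"
      using \<omega> by (simp add: carrier_fundamental_group)
    moreover have "base_change M d (loop_class M c ?\<omega>) = loop_class M b \<gamma>"
      using base_change_loop_class[OF dM] \<omega> conjugate_loop_reverse[OF dM] \<gamma> by (simp add: d loop_class_eqI)
    moreover have "base_change M d (g [^]\<^bsub>fundamental_group M c\<^esub> (j * L)) = (base_change M d g [^]\<^bsub>?G\<^esub> j) [^]\<^bsub>?G\<^esub> L"
      using g by (simp add: \<beta>.hom_nat_pow G.nat_pow_pow)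
    ultimately have "f (loop_class P.M b' p) = loop_class M b \<gamma> \<otimes>\<^bsub>?G\<^esub> (base_change M d g [^]\<^bsub>?G\<^esub> j) [^]\<^bsub>?G\<^esub> L"
      using g by simp
    moreover have "p \<in> loops (subtopology P.M ?B') b'" if "\<gamma> \<in> loops (subtopology M ?B) b"
    proof -
      have "?\<omega> \<in> loops (subtopology M ?B) c"
        using conjugate_loop_in_loops[OF pathin_reverse_path[OF dB], of \<gamma>] that d by simp
      then show ?thesis using p(1) pB by (simp add: loops_subtopology)
    qed
    moreover have "base_change M d g [^]\<^bsub>?G\<^esub> j \<in> carrier ?G" using g by simp
    ultimately show ?thesis using p(1) by blast
  qed
  have "\<exists>Q\<in>finite_quotient_pairs (?G', ?H'). pair_iso (quotient_pair (?G, ?H) N) Q"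
  proof (rule finite_quotient_pair_pullback[OF G.is_group group_fundamental_group[OF bM'] N(2) fin f_hom])
    show "?H \<subseteq> carrier ?G" "?H' \<subseteq> carrier ?G'"
      by (auto simp: carrier_fundamental_group loops_subtopology)
    show "f ` ?H' \<subseteq> ?H"
    proof clarify
      fix p assume p: "p \<in> loops (subtopology P.M ?B') b'"
      have "flow_map u \<circ> p \<in> loops (subtopology M ?B) c"
      proof -
        have "flow_map u (p s) \<in> ?B" if s: "s \<in> {0..1}" for s
        proof -
          have "p s \<in> ?B'" using p s by (simp add: loops_subtopology)
          then obtain x t where "x \<in> topspace F" "x \<in> manifold_boundary 2 F" "p s = P.q (x, t)"
            using P.boundary_of_M_cases[OF F] by blast
          then show ?thesis using q_in_boundary_iff[OF F] flow_map_q_power by simp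
        qed
        then show ?thesis
          using p comp_in_loops[OF continuous_map_flow_map, of p u b'] by (simp add: loops_subtopology flow_b')
      qed
      then have "conjugate_loop d (flow_map u \<circ> p) \<in> loops (subtopology M ?B) b"
        using conjugate_loop_in_loops[OF dB] d by simp
      then show "f (loop_class P.M b' p) \<in> ?H"
        using f_class p by (simp add: loops_subtopology)
    qed
    show "\<exists>g'\<in>carrier ?G'. \<exists>x\<in>carrier ?G. f g' = g \<otimes>\<^bsub>?G\<^esub> x [^]\<^bsub>?G\<^esub> card (rcosets\<^bsub>?G\<^esub> N)"
      if "g \<in> carrier ?G" for g
      using that lift unfolding carrier_fundamental_group L_def by blast
    show "\<exists>g'\<in>?H'. \<exists>x\<in>carrier ?G. f g' = g \<otimes>\<^bsub>?G\<^esub> x [^]\<^bsub>?G\<^esub> card (rcosets\<^bsub>?G\<^esub> N)"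
      if gH: "g \<in> ?H" for g
    proof -
      obtain \<gamma> where "g = loop_class M b \<gamma>" "\<gamma> \<in> loops (subtopology M ?B) b" using gH by blast
      then show ?thesis using lift[of \<gamma>] unfolding L_def loops_subtopology by blast
    qed
  qed
  then show ?thesis using N(1) Mv by (simp add: peripheral_pair_eq)
qed

lemma homeo_power_eq_act:
  assumes "inj_on \<phi> (topspace F)" "x \<in> topspace F"
  shows "homeo_power F \<phi> k x = act k x"
proof (cases "k \<ge> 0")
  case True
  then show ?thesis using act_of_nat[OF assms(2), of "nat k"] by (simp add: homeo_power_def)
next
  case False
  have inv: "inv_into (topspace F) \<phi> y = act (- 1) y" if "y \<in> topspace F" for y
    using act_uminus(1)[OF that, of 1] act_1[of "act (- 1) y"] that
    by (intro inv_into_f_eq[OF assms(1)]) auto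
  have "(inv_into (topspace F) \<phi> ^^ a) x = act (- int a) x" for a
  proof (induction a)
    case (Suc a)
    then show ?case
      using inv[of "act (- int a) x"] act_add[OF assms(2), of "- 1" "- int a"] assms(2) by simp
  qed simp
  from this[of "nat (- k)"] show ?thesis using False by (simp add: homeo_power_def)
qed

end

lemma pair_iso_sym_quotient:
  assumes "A \<in> finite_quotient_pairs (peripheral_pair X b)" "b \<in> topspace X" "pair_iso A B"
  shows "pair_iso B A"
proof -
  obtain N where N: "A = quotient_pair (peripheral_pair X b) N" "N \<lhd> fundamental_group X b"
    using assms(1) by (auto simp: finite_quotient_pairs_def peripheral_pair_eq)
  show ?thesis
  proof (rule pair_iso_sym[OF _ _ assms(3)])
    show "group (fst A)"
      using N by (simp add: quotient_pair_def peripheral_pair_eq normal.factorgroup_is_group)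
    show "snd A \<subseteq> carrier (fst A)"
      by (auto simp: N quotient_pair_def peripheral_pair_eq carrier_FactGroup carrier_fundamental_group loops_subtopology)
  qed
qed

theorem theorem1p2:
  fixes F :: "'a topology"
    and \<mu> :: "'a \<Rightarrow> 'a chain set"
    and \<phi> :: "'a \<Rightarrow> 'a"
    and k :: int
    and b b' :: "('a \<times> real) set"
  assumes "manifold_with_boundary 2 F"
    and "compact_space F"
    and "connected_space F"
    and "manifold_orientation 2 F \<mu>"
    and "card (connected_components_of (subtopology F (manifold_boundary 2 F))) = 1"
    and "homeomorphic_map F F \<phi>"
    and "orientation_preserving 2 F \<mu> \<phi>"
    and "periodic_on F \<phi>"
    and "coprime k (int (homeo_order F \<phi>))"
    and "b \<in> manifold_boundary 3 (mapping_torus F \<phi>)"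
    and "b' \<in> manifold_boundary 3 (mapping_torus F (homeo_power F \<phi> k))"
  shows "same_finite_quotients
           (peripheral_pair (mapping_torus F \<phi>) b)
           (peripheral_pair (mapping_torus F (homeo_power F \<phi> k)) b')"
proof -
  define n where "n = homeo_order F \<phi>"
  have n: "n \<ge> 1 \<and> (\<forall>x\<in>topspace F. (\<phi> ^^ n) x = x)"
    using assms(8) unfolding n_def homeo_order_def periodic_on_def by (elim exE) (rule LeastI)
  interpret periodic_map F \<phi> n
    using n homeomorphic_imp_continuous_map[OF assms(6)] by unfold_locales auto
  define v where "v = nat (k mod int n)"
  have v_int: "int v = k mod int n" using n by (simp add: v_def)
  have "coprime (int v) (int n)"
    using assms(9) n unfolding v_int n_def[symmetric] by (simp add: coprime_mod_left_iff)
  then have v: "coprime v n" by simp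
  have inj: "inj_on \<phi> (topspace F)"
    using assms(6) by (simp add: homeomorphic_eq_everything_map)
  have "homeo_power F \<phi> k x = (\<phi> ^^ v) x" if "x \<in> topspace F" for x
    using homeo_power_eq_act[OF inj that] act_of_nat[OF that, of v] act_cong[of k "int v"]
    by (simp add: v_int)
  then have torus: "mapping_torus F (homeo_power F \<phi> k) = mapping_torus F (\<phi> ^^ v)"
    by (rule mapping_torus_cong)
  have b': "b' \<in> manifold_boundary 3 (mapping_torus F (\<phi> ^^ v))" using assms(11) torus by simp
  interpret P: periodic_map F "\<phi> ^^ v" n by (rule periodic_map_power)
  \<comment> \<open>\<open>\<phi>\<close> is itself a power of \<open>\<phi>\<^sup>k\<close>, which gives the converse direction.\<close>
  obtain w where w: "[v * w = Suc 0] (mod n)"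
    using cong_solve_coprime_nat[OF v] by blast
  then have w': "coprime w n"
    by (metis One_nat_def cong_imp_coprime cong_sym coprime_1_left coprime_mult_left_iff)
  have "((\<phi> ^^ v) ^^ w) x = \<phi> x" if "x \<in> topspace F" for x
  proof -
    have "((\<phi> ^^ v) ^^ w) x = act (int (v * w)) x" using act_of_nat[OF that, of "v * w"] by (simp add: funpow_mult)
    also have "act (int (v * w)) = act 1"
    proof (rule act_cong)
      have "[int (v * w) = int 1] (mod int n)" using w unfolding cong_int_iff by simp
      then show "int (v * w) mod int n = 1 mod int n" by (simp only: cong_def of_nat_1)
    qed
    finally show ?thesis using that by simp
  qed
  then have torus': "mapping_torus F ((\<phi> ^^ v) ^^ w) = M" by (rule mapping_torus_cong)
  have "\<exists>B\<in>finite_quotient_pairs (peripheral_pair P.M b'). pair_iso A B"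
    if "A \<in> finite_quotient_pairs (peripheral_pair M b)" for A
    using finite_quotient_of_power[OF assms(1,5) v assms(10) b' that] .
  moreover have "\<exists>A\<in>finite_quotient_pairs (peripheral_pair M b). pair_iso A B"
    if B: "B \<in> finite_quotient_pairs (peripheral_pair P.M b')" for B
  proof -
    have "b' \<in> topspace P.M" using b' by (simp add: manifold_boundary_def)
    then show ?thesis
      using P.finite_quotient_of_power[OF assms(1,5) w' b' _ B, of b] assms(10) pair_iso_sym_quotient[OF B]
      unfolding torus' by blast
  qed
  ultimately show ?thesis
    unfolding same_finite_quotients_def torus by blast
qed

end
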